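(* Let $p$ be an odd prime and $b\in\mathbb{Q}_p$ with $v_p(b^{p-1}-1)=1$. Choose $\beta_0=b$ and elements $\beta_i$ ($i\ge1$) of an algebraic closure with $\beta_i^p=\beta_{i-1}$, and set $K_0=\mathbb{Q}_p(\zeta_p)$, $K_i=\mathbb{Q}_p(\zeta_p,\beta_i)$. Then for every $i\ge1$, $K_i/K_{i-1}$ is Galois with cyclic Galois group of order $p$, and the unique break number of its ramification groups (the integer $t$ with $G_t=\mathrm{Gal}(K_i/K_{i-1})$ and $G_{t+1}=1$ in lower numbering) is $b_i=1+p(p^{i-1}-1)$.
   Context: $\zeta_p$ is a primitive $p$-th root of unity; lower numbering of ramification groups as in Serre, Local Fields, Ch. IV. *)

theory Defs
  imports
    "Berlekamp_Zassenhaus.Finite_Field"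
    "HOL-Computational_Algebra.Fraction_Field"
    "HOL-Algebra.Algebraic_Closure_Type"
    "HOL-Algebra.Generated_Fields"
    "HOL-Algebra.Ideal_Product"
    "HOL-Algebra.Elementary_Groups"
    "HOL-Algebra.Bij"
begin

section \<open>The p-adic numbers\<close>

text \<open>
  The prime is \<open>CARD('p)\<close>. The ring of p-adic integers is the inverse limit of the rings
  of integers modulo \<open>p ^ n\<close>; a compatible sequence is stored by its least nonnegative
  representatives.
\<close>

typedef (overloaded) 'p::prime_card padic_int =
  "{f :: nat \<Rightarrow> int. \<forall>n. f n \<in> {0..<int CARD('p) ^ n} \<and> f (Suc n) mod int CARD('p) ^ n = f n}"
proof
  have "int CARD('p) > 0" using prime_card_int[where 'a='p] prime_gt_0_int by blast
  then show "(\<lambda>_. 0) \<in> {f :: nat \<Rightarrow> int. \<forall>n. f n \<in> {0..<int CARD('p) ^ n} \<and>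
      f (Suc n) mod int CARD('p) ^ n = f n}" by simp
qed

setup_lifting type_definition_padic_int

lemma card_gt_1 [simp]: "int CARD('p::prime_card) > 1"
  using prime_card_int[where 'a='p] prime_gt_1_int by blast

lemma card_gt_0 [simp]: "int CARD('p::prime_card) > 0"
  using card_gt_1[where 'p='p] by linarith

lemma mod_Suc_power: "(x mod int CARD('p) ^ Suc n) mod int CARD('p) ^ n = x mod int CARD('p::prime_card) ^ n"
  by (rule mod_mod_cancel) (simp add: le_imp_power_dvd)

instantiation padic_int :: (prime_card) comm_ring_1
begin

lift_definition zero_padic_int :: "'a padic_int" is "\<lambda>_. 0" by simp

lift_definition one_padic_int :: "'a padic_int" is "\<lambda>n. 1 mod int CARD('a) ^ n"
  by (simp add: mod_Suc_power del: power_Suc)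

lift_definition plus_padic_int :: "'a padic_int \<Rightarrow> 'a padic_int \<Rightarrow> 'a padic_int"
  is "\<lambda>f g n. (f n + g n) mod int CARD('a) ^ n"
  by (simp add: mod_Suc_power del: power_Suc) (metis mod_add_eq)

lift_definition uminus_padic_int :: "'a padic_int \<Rightarrow> 'a padic_int"
  is "\<lambda>f n. (- f n) mod int CARD('a) ^ n"
  by (simp add: mod_Suc_power del: power_Suc) (metis mod_minus_eq)

lift_definition minus_padic_int :: "'a padic_int \<Rightarrow> 'a padic_int \<Rightarrow> 'a padic_int"
  is "\<lambda>f g n. (f n - g n) mod int CARD('a) ^ n"
  by (simp add: mod_Suc_power del: power_Suc) (metis mod_diff_eq)

lift_definition times_padic_int :: "'a padic_int \<Rightarrow> 'a padic_int \<Rightarrow> 'a padic_int"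
  is "\<lambda>f g n. (f n * g n) mod int CARD('a) ^ n"
  by (simp add: mod_Suc_power del: power_Suc) (metis mod_mult_eq)

instance
proof
  fix a b c :: "'a padic_int"
  show "a * b * c = a * (b * c)"
    by transfer (auto simp: mod_simps algebra_simps)
  show "a * b = b * a"
    by transfer (auto simp: algebra_simps)
  show "1 * a = a"
    by transfer (auto simp: mod_simps fun_eq_iff)
  show "a + b + c = a + (b + c)"
    by transfer (auto simp: mod_simps algebra_simps)
  show "a + b = b + a"
    by transfer (auto simp: algebra_simps)
  show "0 + a = a"
    by transfer (auto simp: fun_eq_iff)
  show "- a + a = 0"
    by transfer (auto simp: mod_simps fun_eq_iff)
  show "a - b = a + - b"
    by transfer (auto simp: mod_simps fun_eq_iff)
  show "(a + b) * c = a * c + b * c"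
    by transfer (auto simp: mod_simps algebra_simps)
  show "(0 :: 'a padic_int) \<noteq> 1"
    using card_gt_1[where 'p='a] by transfer (auto simp: fun_eq_iff intro!: exI[of _ 1])
qed

end

lemma Rep_padic_int_mod_power:
  assumes "m \<le> n"
  shows "Rep_padic_int (x :: 'p::prime_card padic_int) n mod int CARD('p) ^ m = Rep_padic_int x m"
  using assms
proof (induction n rule: dec_induct)
  case base
  show ?case using Rep_padic_int[of x] by auto
next
  case (step n)
  have "Rep_padic_int x (Suc n) mod int CARD('p) ^ m
      = (Rep_padic_int x (Suc n) mod int CARD('p) ^ n) mod int CARD('p) ^ m"
    by (rule mod_mod_cancel[symmetric]) (use step in \<open>simp add: le_imp_power_dvd\<close>)
  also have "Rep_padic_int x (Suc n) mod int CARD('p) ^ n = Rep_padic_int x n"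
    using Rep_padic_int[of x] by auto
  finally show ?case using step.IH by simp
qed

instance padic_int :: (prime_card) idom
proof
  fix a b :: "'a padic_int"
  assume "a \<noteq> 0" "b \<noteq> 0"
  then obtain m n where m: "Rep_padic_int a m \<noteq> 0" and n: "Rep_padic_int b n \<noteq> 0"
    by (metis Rep_padic_int_inject ext zero_padic_int.rep_eq)
  let ?p = "int CARD('a)" and ?a = "Rep_padic_int a (m + n)" and ?b = "Rep_padic_int b (m + n)"
  have "\<not> ?p ^ m dvd ?a" "\<not> ?p ^ n dvd ?b"
    using m n Rep_padic_int_mod_power[of m "m + n" a] Rep_padic_int_mod_power[of n "m + n" b]
    by (auto simp: dvd_eq_mod_eq_0)
  moreover have "m > 0"
    using m Rep_padic_int[of a] by (cases m) (auto dest: spec[of _ 0])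
  ultimately have "\<not> ?p ^ (m + n - 1) dvd ?a * ?b"
    using prime_elem_power_dvd_cases[of ?p "m + n - 1" ?a ?b m n] prime_card_int[where 'a='a]
    by (auto simp: prime_imp_prime_elem)
  then have "\<not> ?p ^ (m + n) dvd ?a * ?b"
    by (meson diff_le_self dvd_trans le_imp_power_dvd)
  then have "Rep_padic_int (a * b) (m + n) \<noteq> 0"
    by (simp add: times_padic_int.rep_eq dvd_eq_mod_eq_0)
  then show "a * b \<noteq> 0" by (auto simp: zero_padic_int.rep_eq)
qed

type_synonym 'p padic = "'p padic_int fract"

text \<open>
  Every nonzero \<open>x\<close> is \<open>p powi k * u\<close> with a unique integer \<open>k\<close> and a unit \<open>u\<close> of the
  p-adic integers; \<open>k\<close> is the valuation. The value at \<open>0\<close>, mathematically infinite, is the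
  dummy \<open>0\<close>.
\<close>

definition padic_val :: "'p::prime_card padic \<Rightarrow> int" where
  "padic_val x = (if x = 0 then 0 else
     (THE k. \<exists>u :: 'p padic_int. u dvd 1 \<and> x = of_nat CARD('p) powi k * Fract u 1))"


lemma Rep_padic_int_of_nat:
  "Rep_padic_int (of_nat k :: 'p::prime_card padic_int) n = int k mod int CARD('p) ^ n"
proof (induction k)
  case (Suc k)
  then show ?case
    by (simp add: plus_padic_int.rep_eq one_padic_int.rep_eq mod_simps)
qed (simp add: zero_padic_int.rep_eq)

lemma padic_int_unit_iff:
  "(u :: 'p::prime_card padic_int) dvd 1 \<longleftrightarrow> Rep_padic_int u 1 \<noteq> 0"
proof
  assume "u dvd 1"
  then obtain v where "u * v = 1" by (metis dvdE)
  then have "Rep_padic_int (u * v) 1 = 1" by (simp add: one_padic_int.rep_eq)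
  then show "Rep_padic_int u 1 \<noteq> 0" by (auto simp: times_padic_int.rep_eq)
next
  let ?p = "int CARD('p)"
  assume u: "Rep_padic_int u 1 \<noteq> 0"
  have cop: "coprime (Rep_padic_int u n) (?p ^ n)" for n
  proof (cases "n = 0")
    case False
    then have "Rep_padic_int u n mod ?p \<noteq> 0"
      using u Rep_padic_int_mod_power[of 1 n u] by simp
    then have "coprime ?p (Rep_padic_int u n)"
      using prime_card_int[where 'a='p] by (auto intro!: prime_imp_coprime simp: dvd_eq_mod_eq_0)
    then show ?thesis by (simp add: ac_simps)
  qed simp
  have "\<exists>y. y \<in> {0..<?p ^ n} \<and> (Rep_padic_int u n * y) mod ?p ^ n = 1 mod ?p ^ n" for n
  proof -
    obtain y where "[Rep_padic_int u n * y = 1] (mod ?p ^ n)"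
      using cop cong_solve_coprime_int by blast
    then show ?thesis
      by (intro exI[of _ "y mod ?p ^ n"]) (simp add: cong_def mod_simps)
  qed
  then obtain g where g: "\<And>n. g n \<in> {0..<?p ^ n}"
      "\<And>n. (Rep_padic_int u n * g n) mod ?p ^ n = 1 mod ?p ^ n"
    by metis
  have "g (Suc n) mod ?p ^ n = g n" for n
  proof -
    have "(Rep_padic_int u n * g (Suc n)) mod ?p ^ n
        = (Rep_padic_int u (Suc n) * g (Suc n)) mod ?p ^ Suc n mod ?p ^ n"
      using Rep_padic_int_mod_power[of n "Suc n" u]
      by (metis le_add2 mod_Suc_power mod_mult_left_eq plus_1_eq_Suc)
    also have "\<dots> = (Rep_padic_int u n * g n) mod ?p ^ n"
      by (simp only: g(2) mod_Suc_power)
    finally have "[g (Suc n) = g n] (mod ?p ^ n)"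
      using cop[of n] by (simp add: cong_def[symmetric] cong_mult_lcancel)
    then show ?thesis using g(1)[of n] by (simp add: cong_def)
  qed
  then have "Rep_padic_int (Abs_padic_int g :: 'p padic_int) = g"
    using g(1) by (intro Abs_padic_int_inverse) auto
  then have "u * Abs_padic_int g = 1"
    using g(2) by (simp add: Rep_padic_int_inject[symmetric] times_padic_int.rep_eq
      one_padic_int.rep_eq fun_eq_iff)
  then show "u dvd 1" by (metis dvdI)
qed

lemma padic_int_decompose:
  assumes "(x :: 'p::prime_card padic_int) \<noteq> 0"
  shows "\<exists>k u. u dvd 1 \<and> x = of_nat CARD('p) ^ k * u"
proof -
  let ?p = "int CARD('p)"
  define m where "m = (LEAST n. Rep_padic_int x n \<noteq> 0)"
  have "\<exists>n. Rep_padic_int x n \<noteq> 0"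
    using assms by (metis Rep_padic_int_inject ext zero_padic_int.rep_eq)
  then have m: "Rep_padic_int x m \<noteq> 0" unfolding m_def by (rule LeastI_ex)
  have "m > 0"
    using m Rep_padic_int[of x] by (cases m) (auto dest: spec[of _ 0])
  then obtain k where k: "m = Suc k" by (cases m) auto
  have k0: "Rep_padic_int x k = 0"
    using not_less_Least[of k "\<lambda>n. Rep_padic_int x n \<noteq> 0"] k unfolding m_def by auto
  define g where "g n = Rep_padic_int x (n + k) div ?p ^ k" for n
  have g: "?p ^ k * g n = Rep_padic_int x (n + k)" for n
    using Rep_padic_int_mod_power[of k "n + k" x] k0 unfolding g_def by auto
  have rng: "Rep_padic_int x n \<in> {0..<?p ^ n}" for n
    using Rep_padic_int[of x] by auto
  have "g n \<in> {0..<?p ^ n}" for n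
    using rng[of "n + k"] zero_less_power[OF card_gt_0[where 'p='p], of k] unfolding g[symmetric]
    by (auto simp: power_add zero_le_mult_iff mult.commute[of "?p ^ n"] not_le)
  moreover have "g (Suc n) mod ?p ^ n = g n" for n
  proof -
    have "?p ^ k * (g (Suc n) mod ?p ^ n) = Rep_padic_int x (Suc n + k) mod ?p ^ (n + k)"
      by (simp only: g[symmetric] power_add mult.commute[of "?p ^ n"] mult_mod_right)
    also have "\<dots> = ?p ^ k * g n"
      using Rep_padic_int_mod_power[of "n + k" "Suc n + k" x] g by simp
    finally show ?thesis by simp
  qed
  ultimately have Rep: "Rep_padic_int (Abs_padic_int g :: 'p padic_int) = g"
    by (intro Abs_padic_int_inverse) auto
  have "g 1 \<noteq> 0" using g[of 1] m k by auto
  then have "(Abs_padic_int g :: 'p padic_int) dvd 1"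
    by (simp add: padic_int_unit_iff Rep)
  moreover have "x = of_nat CARD('p) ^ k * Abs_padic_int g"
  proof -
    have "Rep_padic_int x n = (?p ^ k mod ?p ^ n * g n) mod ?p ^ n" for n
      using Rep_padic_int_mod_power[of n "n + k" x] g[of n] by (simp add: mod_simps)
    then show ?thesis
      using Rep_padic_int_of_nat[of "CARD('p) ^ k", where 'p='p]
      by (simp add: Rep_padic_int_inject[symmetric] times_padic_int.rep_eq Rep fun_eq_iff)
  qed
  ultimately show ?thesis by blast
qed

lemma padic_val_eqI:
  fixes u :: "'p::prime_card padic_int"
  assumes "u dvd 1" and x: "x = of_nat CARD('p) powi k * Fract u 1"
  shows "padic_val x = k"
proof -
  let ?p = "of_nat CARD('p) :: 'p padic_int"
  have p_nonunit: "\<not> ?p dvd 1"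
    by (simp add: padic_int_unit_iff Rep_padic_int_of_nat)
  have u_nz: "u \<noteq> 0" using assms(1) by auto
  have "?p \<noteq> 0"
  proof
    assume "?p = 0"
    then have "Rep_padic_int ?p 2 = 0" by (simp add: zero_padic_int.rep_eq)
    then have "int CARD('p) ^ 2 dvd int CARD('p)"
      by (simp only: Rep_padic_int_of_nat dvd_eq_mod_eq_0)
    then show False
      using card_gt_1[where 'p='p] zdvd_imp_le[of "int CARD('p) ^ 2" "int CARD('p)"]
      by (auto simp: power2_eq_square)
  qed
  then have P_nz: "(of_nat CARD('p) :: 'p padic) \<noteq> 0"
    by (simp add: of_nat_fract Zero_fract_def eq_fract)
  have no_less: False if "i < j" "v dvd 1" "w dvd 1"
    "of_nat CARD('p) powi i * Fract v 1 = of_nat CARD('p) powi j * Fract w 1"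
    for i j and v w :: "'p padic_int"
  proof -
    have "Fract v 1 = of_nat CARD('p) powi (j - i) * Fract w 1"
      using that(4) P_nz by (simp add: power_int_diff field_simps)
    also have "of_nat CARD('p) powi (j - i) = (of_nat CARD('p) :: 'p padic) ^ nat (j - i)"
      using that(1) by (simp add: power_int_def)
    also have "\<dots> = Fract (?p ^ nat (j - i)) 1"
      by (metis of_nat_fract of_nat_power)
    finally have "v = ?p ^ nat (j - i) * w" by (simp add: eq_fract)
    then have "?p dvd v" using that(1) by (simp add: dvd_mult2 dvd_power)
    then show False using that(2) p_nonunit dvd_trans by blast
  qed
  have "Fract u 1 \<noteq> 0" using u_nz by (simp add: Zero_fract_def eq_fract)
  then have "x \<noteq> 0" using x P_nz by simp
  moreover have "(THE k. \<exists>u :: 'p padic_int. u dvd 1 \<and> x = of_nat CARD('p) powi k * Fract u 1) = k"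
  proof (rule the_equality)
    show "\<exists>u :: 'p padic_int. u dvd 1 \<and> x = of_nat CARD('p) powi k * Fract u 1" using assms by blast
    fix l assume "\<exists>u :: 'p padic_int. u dvd 1 \<and> x = of_nat CARD('p) powi l * Fract u 1"
    then show "l = k" using assms no_less by (metis linorder_neqE)
  qed
  ultimately show ?thesis by (simp add: padic_val_def)
qed

section \<open>Subfields, integers and ramification in the algebraic closure\<close>

definition on_carrier :: "'a::field set \<Rightarrow> 'a ring" where
  "on_carrier A = ring_of_type_algebra\<lparr>carrier := A\<rparr>"

definition Qp_adjoin :: "'p::prime_card padic alg_closure set \<Rightarrow> 'p padic alg_closure set" where
  "Qp_adjoin S = generate_field ring_of_type_algebra (range to_ac \<union> S)"

definition primitive_root_of_unity :: "nat \<Rightarrow> 'a::field \<Rightarrow> bool" where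
  "primitive_root_of_unity n z \<longleftrightarrow> n > 0 \<and> z ^ n = 1 \<and> (\<forall>m. 0 < m \<and> m < n \<longrightarrow> z ^ m \<noteq> 1)"

definition is_min_poly :: "'a::field set \<Rightarrow> 'a \<Rightarrow> 'a poly \<Rightarrow> bool" where
  "is_min_poly K x f \<longleftrightarrow>
     Polynomial.lead_coeff f = 1 \<and> (\<forall>n. Polynomial.coeff f n \<in> K) \<and> poly f x = 0 \<and>
     (\<forall>g. g \<noteq> 0 \<and> (\<forall>n. Polynomial.coeff g n \<in> K) \<and> poly g x = 0 \<longrightarrow>
        Polynomial.degree f \<le> Polynomial.degree g)"

text \<open>
  Algebraic, normal and separable: the minimal polynomial of every element of \<open>L\<close> exists, splits
  over \<open>L\<close>, and its roots are simple (the product is over a set).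
\<close>

definition galois_extension :: "'a::field set \<Rightarrow> 'a set \<Rightarrow> bool" where
  "galois_extension K L \<longleftrightarrow>
     subfield K ring_of_type_algebra \<and> subfield L ring_of_type_algebra \<and> K \<subseteq> L \<and>
     (\<forall>x\<in>L. \<exists>f. is_min_poly K x f \<and> (\<exists>A. finite A \<and> A \<subseteq> L \<and> f = (\<Prod>a\<in>A. [:-a, 1:])))"

definition galois_group :: "'a::field set \<Rightarrow> 'a set \<Rightarrow> ('a \<Rightarrow> 'a) monoid" where
  "galois_group K L = (BijGroup L)\<lparr>carrier :=
     {\<sigma> \<in> Bij L. \<sigma> \<in> Ring.ring_hom (on_carrier L) (on_carrier L) \<and> (\<forall>x\<in>K. \<sigma> x = x)}\<rparr>"

text \<open>The integral closure of the p-adic integers in \<open>L\<close>.\<close>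

definition integer_ring :: "'p::prime_card padic alg_closure set \<Rightarrow> 'p padic alg_closure ring" where
  "integer_ring L = on_carrier {x \<in> L. \<exists>f. Polynomial.lead_coeff f = 1 \<and>
     (\<forall>n. Polynomial.coeff f n \<in> range (\<lambda>a. to_ac (Fract a 1))) \<and> poly f x = 0}"

text \<open>
  For a finite extension \<open>L\<close> of the p-adic numbers \<open>integer_ring L\<close> is a local ring, so its
  nonunits form its maximal ideal.
\<close>

definition prime_of :: "'p::prime_card padic alg_closure set \<Rightarrow> 'p padic alg_closure set" where
  "prime_of L = carrier (integer_ring L) - Units (integer_ring L)"

text \<open>
  Lower numbering: for \<open>n \<ge> -1\<close>, the automorphisms acting trivially on the integers of \<open>L\<close>
  modulo the \<open>(n + 1)\<close>-st power of the maximal ideal.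
\<close>

definition ramification_group ::
  "'p::prime_card padic alg_closure set \<Rightarrow> 'p padic alg_closure set \<Rightarrow> int \<Rightarrow>
     ('p padic alg_closure \<Rightarrow> 'p padic alg_closure) set" where
  "ramification_group K L n = {\<sigma> \<in> carrier (galois_group K L).
     \<forall>x \<in> carrier (integer_ring L).
       \<sigma> x - x \<in> prime_of L [^]\<^bsub>ideals_set (integer_ring L)\<^esub> nat (n + 1)}"

definition break_numbers ::
  "'p::prime_card padic alg_closure set \<Rightarrow> 'p padic alg_closure set \<Rightarrow> int set" where
  "break_numbers K L = {n. n \<ge> -1 \<and> ramification_group K L (n + 1) \<noteq> ramification_group K L n}"

end

theory Submission
  imports Defs "Jordan_Normal_Form.Char_Poly"
begin

text \<open>
  Normalise the valuation by \<open>v(p) = 1\<close> and put \<open>y i = \<beta> i / b - 1\<close>. Since \<open>b ^ (p - 1)\<close> is 1 plus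
  \<open>p\<close> times a unit, \<open>y i\<close> has the valuation \<open>1 / p ^ i\<close>, whereas \<open>\<zeta> - 1\<close> has the valuation
  \<open>1 / (p - 1)\<close>. By induction on \<open>i\<close> the values of \<open>K i\<close> lie in \<open>\<int> / (p ^ i * (p - 1))\<close>, so
  \<open>1, y (i + 1), \<dots>, y (i + 1) ^ (p - 1)\<close> have values that are distinct modulo those of \<open>K i\<close>. Hence
  they are linearly independent over \<open>K i\<close>, the next step is a Kummer extension of degree \<open>p\<close>,
  and a linear combination of them is integral only if each of its terms is. A nontrivial
  automorphism multiplies \<open>y (i + 1)\<close> by \<open>1 + \<epsilon>\<close> with \<open>v(\<epsilon>) = 1 / (p - 1) - 1 / p ^ (i + 1)\<close>, which is
  the break number divided by the ramification index \<open>p ^ (i + 1) * (p - 1)\<close>.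
\<close>

section \<open>Integral elements\<close>

text \<open>No valuation is extended to the algebraic closure. Only integrality over the p-adic
  integers is set up, and x gets the value n / d when x^d is p^n times a unit, so that no roots of p
  are chosen. Every ultrametric estimate comes down to one fact: 1 - x is a unit as soon as some
  power of x is p times an integral element. It also applies to elements whose value is still
  unknown, as happens whenever a first value is read off an equation. The break number needs two
  estimates. One concerns all integers of the upper field, and the expansion in powers of y (i + 1)
  reduces it to single terms. The other needs an integer that is moved as much as possible. For p >
  2 this is not y (i + 1), whose value is p - 1 times the least positive one. The test element is
  the uniformiser (\<zeta> - 1) / y (i + 1)^m with m = 1 + p + ... + p^i: since \<zeta> - 1 is
  fixed, an automorphism multiplies it by (1 + \<epsilon>)^(-m), and m is prime to p.\<close>

locale integral_closure = comm_ring_hom hom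
  for hom :: "'a :: comm_ring_1 \<Rightarrow> 'b :: field"
begin

definition integral :: "'b \<Rightarrow> bool" where
  "integral x \<longleftrightarrow> (\<exists>f. Polynomial.lead_coeff f = 1 \<and> poly (map_poly hom f) x = 0)"

lemma integral_hom: "integral (hom a)"
  unfolding integral_def by (rule exI[of _ "[:-a, 1:]"]) (simp add: hom_uminus)

text \<open>If f is monic and annihilates x^k, then f(X^k) is monic and annihilates x.\<close>

lemma integral_root:
  assumes "integral (x ^ k)" "k > 0"
  shows "integral x"
proof -
  obtain f where f: "Polynomial.lead_coeff f = 1" "poly (map_poly hom f) (x ^ k) = 0"
    using assms(1) unfolding integral_def by blast
  let ?m = "Polynomial.monom 1 k :: 'a poly"
  have deg: "Polynomial.degree (f \<circ>\<^sub>p ?m) \<le> Polynomial.degree f * k"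
    using degree_pcompose_le[of f ?m] by (simp add: Polynomial.degree_monom_eq)
  have top: "Polynomial.coeff (f \<circ>\<^sub>p ?m) (Polynomial.degree f * k) = 1"
    using coeff_pcompose_monom[of 0 k f "Polynomial.degree f"] assms(2) f(1) by (simp add: mult.commute)
  have "Polynomial.lead_coeff (f \<circ>\<^sub>p ?m) = 1"
    using deg top by (metis le_antisym le_degree zero_neq_one)
  moreover have "poly (map_poly hom (f \<circ>\<^sub>p ?m)) x = poly (map_poly hom f) (x ^ k)"
    by (simp add: map_poly_pcompose poly_pcompose poly_monom)
  ultimately show ?thesis using f(2) unfolding integral_def by metis
qed

text \<open>The characteristic polynomial of the matrix of multiplication by \<open>x\<close> on a finitely generated
  module witnesses integrality.\<close>

lemma integral_if_stable:
  assumes I: "finite I" and v: "i0 \<in> I" "v i0 \<noteq> 0"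
    and c: "\<And>i. i \<in> I \<Longrightarrow> x * v i = (\<Sum>j\<in>I. hom (c i j) * v j)"
  shows "integral x"
proof -
  obtain h n where h: "bij_betw h {0..<n::nat} I"
    using ex_bij_betw_nat_finite[OF I] by blast
  define A where "A = mat n n (\<lambda>(i, j). c (h i) (h j))"
  define w where "w = vec n (\<lambda>i. v (h i))"
  have A: "A \<in> carrier_mat n n" by (simp add: A_def)
  have hI: "h i \<in> I" if "i < n" for i using h that by (auto simp: bij_betw_def)
  have "map_mat hom A *\<^sub>v w = x \<cdot>\<^sub>v w"
  proof (rule eq_vecI)
    fix i assume "i < dim_vec (x \<cdot>\<^sub>v w)"
    then have i: "i < n" by (simp add: w_def)
    have "(map_mat hom A *\<^sub>v w) $ i = (\<Sum>j = 0..<n. hom (c (h i) (h j)) * v (h j))"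
      using i by (auto simp: A_def w_def scalar_prod_def intro!: sum.cong)
    also have "\<dots> = (\<Sum>j\<in>I. hom (c (h i) j) * v j)"
      by (rule sum.reindex_bij_betw[OF h])
    also have "\<dots> = x * v (h i)" using c[OF hI[OF i]] by simp
    finally show "(map_mat hom A *\<^sub>v w) $ i = (x \<cdot>\<^sub>v w) $ i" using i by (simp add: w_def)
  qed (simp add: A_def w_def)
  moreover have "w \<noteq> 0\<^sub>v n"
  proof
    assume w0: "w = 0\<^sub>v n"
    obtain i where "i < n" "h i = i0" using h v(1) by (auto simp: bij_betw_def image_iff)
    then show False using w0 v(2) by (auto simp: w_def vec_eq_iff)
  qed
  ultimately have "eigenvector (map_mat hom A) w x"
    using A by (auto simp: eigenvector_def w_def)
  then have "poly (char_poly (map_mat hom A)) x = 0"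
    using eigenvalue_root_char_poly[of "map_mat hom A" n x] A by (auto simp: eigenvalue_def)
  then show ?thesis
    using degree_monic_char_poly[OF A] char_poly_hom[OF A] by (auto simp: integral_def)
qed

lemma integral_power_reduce:
  assumes "integral x"
  obtains m c where "m > 0" "x ^ m = (\<Sum>i<m. hom (c i) * x ^ i)"
proof -
  obtain f where f: "Polynomial.lead_coeff f = 1" "poly (map_poly hom f) x = 0"
    using assms unfolding integral_def by blast
  define m where "m = Polynomial.degree f"
  have "Polynomial.degree (map_poly hom f) = m"
    using f(1) unfolding m_def by (intro map_poly_degree_eq) simp
  then have "0 = (\<Sum>i\<le>m. hom (Polynomial.coeff f i) * x ^ i)"
    using f(2) unfolding poly_altdef by (simp add: coeff_map_poly)
  also have "\<dots> = (\<Sum>i<m. hom (Polynomial.coeff f i) * x ^ i) + x ^ m"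
    using f(1) unfolding m_def lessThan_Suc_atMost[symmetric] sum.lessThan_Suc by simp
  finally have "x ^ m = - (\<Sum>i<m. hom (Polynomial.coeff f i) * x ^ i)"
    by (metis add_eq_0_iff)
  then have eq: "x ^ m = (\<Sum>i<m. hom (- Polynomial.coeff f i) * x ^ i)"
    by (simp add: hom_uminus sum_negf)
  \<comment> \<open>For m = 0 the equation would read 1 = 0.\<close>
  have "m > 0"
  proof (rule ccontr)
    assume "\<not> m > 0"
    then have "m = 0" by simp
    then show False using eq by simp
  qed
  then show ?thesis by (rule that[OF _ eq])
qed

text \<open>The span \<open>M\<close> of the products x^i y^j with i < m and j < n is stable under x
  and under y, hence under x + y and x y. It contains 1 = \<open>e (0, 0)\<close>, so
  \<open>integral_if_stable\<close> applies.\<close>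

lemma integral_add_mult:
  assumes "integral x" "integral y"
  shows "integral (x + y)" "integral (x * y)"
proof -
  obtain m a where m: "m > 0" "x ^ m = (\<Sum>i<m. hom (a i) * x ^ i)"
    using integral_power_reduce[OF assms(1)] .
  obtain n b where n: "n > 0" "y ^ n = (\<Sum>i<n. hom (b i) * y ^ i)"
    using integral_power_reduce[OF assms(2)] .
  define I where "I = {..<m} \<times> {..<n}"
  define e where "e = (\<lambda>(i, j). x ^ i * y ^ j)"
  define M where "M = range (\<lambda>c. \<Sum>s\<in>I. hom (c s) * e s)"
  have fin: "finite I" by (simp add: I_def)
  have M_I: "(\<Sum>s\<in>I. hom (c s) * e s) \<in> M" for c
    by (simp add: M_def)
  have M_add: "u + w \<in> M" if uw: "u \<in> M" "w \<in> M" for u w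
  proof -
    obtain c d where "u = (\<Sum>s\<in>I. hom (c s) * e s)" "w = (\<Sum>s\<in>I. hom (d s) * e s)"
      using uw unfolding M_def by blast
    then have "u + w = (\<Sum>s\<in>I. hom (c s + d s) * e s)"
      by (simp add: hom_add algebra_simps sum.distrib)
    then show ?thesis using M_I by simp
  qed
  have M_scale: "hom r * u \<in> M" if u: "u \<in> M" for u r
  proof -
    obtain c where "u = (\<Sum>s\<in>I. hom (c s) * e s)" using u unfolding M_def by blast
    then have "hom r * u = (\<Sum>s\<in>I. hom (r * c s) * e s)"
      by (simp add: hom_mult sum_distrib_left mult.assoc)
    then show ?thesis using M_I by simp
  qed
  have M_zero: "0 \<in> M"
    using M_I[of "\<lambda>_. 0"] by simp
  have M_sum: "(\<Sum>s\<in>J. hom (c s) * g s) \<in> M" if "finite J" "\<And>s. s \<in> J \<Longrightarrow> g s \<in> M"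
    for J :: "'c set" and c g
    using that by (induction J rule: finite_induct) (auto intro: M_zero M_add M_scale)
  have M_e: "e s \<in> M" if "s \<in> I" for s
  proof -
    have "e s = (\<Sum>t\<in>I. hom (if t = s then 1 else 0) * e t)"
    proof -
      have "(\<Sum>t\<in>I. hom (if t = s then 1 else 0) * e t) = (\<Sum>t\<in>I. if t = s then e t else 0)"
        by (rule sum.cong) auto
      then show ?thesis using that fin by simp
    qed
    then show ?thesis using M_I by metis
  qed
  have stab: "z * u \<in> M" if z: "\<And>s. s \<in> I \<Longrightarrow> z * e s \<in> M" and u: "u \<in> M" for z u
  proof -
    obtain c where "u = (\<Sum>s\<in>I. hom (c s) * e s)" using u unfolding M_def by blast
    then have "z * u = (\<Sum>s\<in>I. hom (c s) * (z * e s))"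
      by (simp add: sum_distrib_left mult.left_commute)
    then show ?thesis using M_sum[OF fin z] by simp
  qed
  have xe: "x * e s \<in> M" if s: "s \<in> I" for s
  proof -
    obtain i j where ij: "s = (i, j)" "i < m" "j < n" using s by (auto simp: I_def)
    show ?thesis
    proof (cases "Suc i = m")
      case True
      then have "x * e s = x ^ m * y ^ j" by (auto simp: ij e_def)
      also have "\<dots> = (\<Sum>i<m. hom (a i) * e (i, j))"
        by (simp add: m(2) sum_distrib_right e_def mult.assoc)
      also have "\<dots> \<in> M"
        by (rule M_sum) (use ij in \<open>auto intro!: M_e simp: I_def\<close>)
      finally show ?thesis .
    next
      case False
      then have "x * e s = e (Suc i, j)" "(Suc i, j) \<in> I" using ij by (auto simp: e_def I_def)
      then show ?thesis using M_e by metis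
    qed
  qed
  have ye: "y * e s \<in> M" if s: "s \<in> I" for s
  proof -
    obtain i j where ij: "s = (i, j)" "i < m" "j < n" using s by (auto simp: I_def)
    show ?thesis
    proof (cases "Suc j = n")
      case True
      then have "y * e s = x ^ i * y ^ n" by (auto simp: ij e_def)
      also have "\<dots> = (\<Sum>j<n. hom (b j) * e (i, j))"
        by (simp add: n(2) sum_distrib_left e_def mult.left_commute)
      also have "\<dots> \<in> M"
        by (rule M_sum) (use ij in \<open>auto intro!: M_e simp: I_def\<close>)
      finally show ?thesis .
    next
      case False
      then have "y * e s = e (i, Suc j)" "(i, Suc j) \<in> I" using ij by (auto simp: e_def I_def)
      then show ?thesis using M_e by metis
    qed
  qed
  have integralI: "integral z" if z: "\<And>s. s \<in> I \<Longrightarrow> z * e s \<in> M" for z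
  proof -
    have "\<forall>s\<in>I. \<exists>c. z * e s = (\<Sum>t\<in>I. hom (c t) * e t)"
      using z unfolding M_def by blast
    then obtain c where "\<And>s. s \<in> I \<Longrightarrow> z * e s = (\<Sum>t\<in>I. hom (c s t) * e t)"
      by metis
    then show ?thesis
      using integral_if_stable[OF fin, of "(0, 0)" e z c] m(1) n(1) by (auto simp: I_def e_def)
  qed
  show "integral (x + y)"
    using xe ye by (intro integralI) (simp add: distrib_right M_add)
  show "integral (x * y)"
    using stab[OF xe ye] by (intro integralI) (simp add: mult.assoc)
qed

end

section \<open>Valuations on the algebraic closure of the p-adic numbers\<close>

definition of_padic_int :: "'p::prime_card padic_int \<Rightarrow> 'p padic alg_closure" where
  "of_padic_int a = to_ac (Fract a 1)"

interpretation padic: integral_closure "of_padic_int :: 'p::prime_card padic_int \<Rightarrow> 'p padic alg_closure"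
  by unfold_locales
    (simp_all add: of_padic_int_def flip: Zero_fract_def One_fract_def to_ac_add to_ac_mult)

lemma of_padic_int_of_nat [simp]: "of_padic_int (of_nat n) = of_nat n"
  by (simp add: of_padic_int_def flip: of_nat_fract)

lemma of_padic_int_eq_iff [simp]: "of_padic_int a = of_padic_int b \<longleftrightarrow> a = b"
  by (simp add: of_padic_int_def eq_fract)

lemma prime_num_neq_0 [simp]: "(of_nat CARD('p) :: 'p::prime_card padic alg_closure) \<noteq> 0"
proof -
  \<comment> \<open>Residues modulo p^2 are compared, because modulo p the element is 0.\<close>
  have "Rep_padic_int (of_nat CARD('p) :: 'p padic_int) 2 \<noteq> 0"
  proof
    assume "Rep_padic_int (of_nat CARD('p) :: 'p padic_int) 2 = 0"
    then have "int CARD('p) ^ 2 dvd int CARD('p)"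
      by (simp only: Rep_padic_int_of_nat dvd_eq_mod_eq_0)
    then show False
      using card_gt_1[where 'p='p] zdvd_imp_le[of "int CARD('p) ^ 2" "int CARD('p)"]
      by (auto simp: power2_eq_square)
  qed
  then have "(of_nat CARD('p) :: 'p padic_int) \<noteq> 0"
    by (auto simp: zero_padic_int.rep_eq)
  then show ?thesis
    by (metis of_padic_int_eq_iff of_padic_int_of_nat of_nat_0)
qed

lemma integral_0 [simp, intro]: "padic.integral 0"
  and integral_1 [simp, intro]: "padic.integral 1"
  and integral_of_nat [simp, intro]: "padic.integral (of_nat n)"
  using padic.integral_hom[of 0] padic.integral_hom[of 1] padic.integral_hom[of "of_nat n"]
  by simp_all

lemma integral_uminus [intro]: "padic.integral x \<Longrightarrow> padic.integral (- x)"
  using padic.integral_add_mult(2)[OF padic.integral_hom[of "-1"]] by (auto simp: padic.hom_uminus)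

lemmas integral_add [intro] = padic.integral_add_mult(1)
lemmas integral_mult [intro] = padic.integral_add_mult(2)

lemma integral_diff [intro]: "padic.integral x \<Longrightarrow> padic.integral y \<Longrightarrow> padic.integral (x - y)"
  using integral_add[of x "- y"] by auto

lemma integral_power [intro]: "padic.integral x \<Longrightarrow> padic.integral (x ^ n)"
  by (induction n) auto

lemma integral_sum [intro]: "(\<And>i. i \<in> A \<Longrightarrow> padic.integral (f i)) \<Longrightarrow> padic.integral (\<Sum>i\<in>A. f i)"
  by (induction A rule: infinite_finite_induct) auto

section \<open>Units of the ring of integers of the algebraic closure\<close>

definition int_unit :: "'p::prime_card padic alg_closure \<Rightarrow> bool" where
  "int_unit x \<longleftrightarrow> x \<noteq> 0 \<and> padic.integral x \<and> padic.integral (inverse x)"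

lemma int_unit_1 [simp, intro]: "int_unit 1"
  by (simp add: int_unit_def)

lemma int_unit_mult [intro]: "int_unit x \<Longrightarrow> int_unit y \<Longrightarrow> int_unit (x * y)"
  by (auto simp: int_unit_def)

lemma int_unit_inverse [intro]: "int_unit x \<Longrightarrow> int_unit (inverse x)"
  by (auto simp: int_unit_def)

lemma int_unit_divide [intro]: "int_unit x \<Longrightarrow> int_unit y \<Longrightarrow> int_unit (x / y)"
  by (simp add: divide_inverse int_unit_mult int_unit_inverse)

lemma int_unit_uminus [intro]: "int_unit x \<Longrightarrow> int_unit (- x)"
  by (auto simp: int_unit_def)

lemma int_unit_power [intro]: "int_unit x \<Longrightarrow> int_unit (x ^ n)"
  by (induction n) auto

lemma int_unit_root: "int_unit (x ^ n) \<Longrightarrow> n > 0 \<Longrightarrow> int_unit x"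
  using padic.integral_root[of x n] padic.integral_root[of "inverse x" n]
  by (auto simp: int_unit_def power_inverse)

text \<open>Units will mostly be recognised as integral divisors of known units, for instance 1 - x
  as a divisor of 1 - x^k.\<close>

lemma int_unit_factor:
  assumes "int_unit (x * y)" "padic.integral x" "padic.integral y"
  shows "int_unit x"
proof -
  have "inverse x = y * inverse (x * y)"
    using assms(1) by (simp add: int_unit_def)
  then show ?thesis
    using assms unfolding int_unit_def by (metis integral_mult mult_eq_0_iff)
qed

lemma int_unit_of_padic_int:
  assumes "u dvd 1"
  shows "int_unit (of_padic_int u)"
proof -
  obtain v where "u * v = 1" using assms by (metis dvdE)
  then have "of_padic_int u * of_padic_int v = 1"
    by (metis padic.hom_mult padic.hom_one)
  then show ?thesis
    by (intro int_unit_factor[of "of_padic_int u" "of_padic_int v"] padic.integral_hom) simp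
qed

lemma int_unit_of_nat:
  assumes "\<not> CARD('p) dvd n"
  shows "int_unit (of_nat n :: 'p::prime_card padic alg_closure)"
proof -
  have "(of_nat n :: 'p padic_int) dvd 1"
    using assms unfolding padic_int_unit_iff Rep_padic_int_of_nat power_one_right zmod_int[symmetric]
    by (simp add: mod_eq_0_iff_dvd)
  then show ?thesis using int_unit_of_padic_int[of "of_nat n :: 'p padic_int"] by simp
qed

text \<open>With \<open>t = p w\<close>, an integral equation of \<open>w\<close> gives \<open>t ^ n = (\<Sum>i<n. c i * p ^ (n - i) * t ^ i)\<close>.
  Modulo \<open>1 - t\<close> it reads \<open>1 = (\<Sum>i<n. c i * p ^ (n - i))\<close>, so \<open>1 - t\<close> divides a unit.\<close>

lemma int_unit_one_minus_prime_mult: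
  fixes w :: "'p::prime_card padic alg_closure"
  assumes "padic.integral w"
  shows "int_unit (1 - of_nat CARD('p) * w)"
proof -
  let ?p = "of_nat CARD('p) :: 'p padic alg_closure"
  define t where "t = ?p * w"
  obtain n c where n: "n > 0" "w ^ n = (\<Sum>i<n. of_padic_int (c i) * w ^ i)"
    using padic.integral_power_reduce[OF assms] .
  have t: "padic.integral t" using assms by (auto simp: t_def)
  \<comment> \<open>All exponents n - i are at least 1, so a factor p splits off the sum of the c i
    p^(n - i), and a is what remains. Then 1 - p a is a p-adic unit by its residue modulo p.\<close>
  define a where "a = (\<Sum>i<n. c i * of_nat CARD('p) ^ (n - 1 - i))"
  define r where "r i = (\<Sum>j<i. t ^ j)" for i
  define q where "q = (\<Sum>i<n. of_padic_int (c i) * ?p ^ (n - i) * r i)"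
  have r: "1 - t ^ i = (1 - t) * r i" for i
    by (simp add: r_def one_diff_power_eq)
  have "t ^ n = (\<Sum>i<n. of_padic_int (c i) * ?p ^ (n - i) * t ^ i)"
    unfolding t_def power_mult_distrib n(2) sum_distrib_left
  proof (rule sum.cong)
    fix i assume "i \<in> {..<n}"
    then have "?p ^ n = ?p ^ (n - i) * ?p ^ i" by (simp flip: power_add)
    then show "?p ^ n * (of_padic_int (c i) * w ^ i) = of_padic_int (c i) * ?p ^ (n - i) * (?p ^ i * w ^ i)"
      by simp
  qed simp
  also have "\<dots> = (\<Sum>i<n. of_padic_int (c i) * ?p ^ (n - i))
      - (\<Sum>i<n. of_padic_int (c i) * ?p ^ (n - i) * (1 - t ^ i))"
    by (simp add: algebra_simps sum_subtractf)
  also have "(\<Sum>i<n. of_padic_int (c i) * ?p ^ (n - i) * (1 - t ^ i)) = (1 - t) * q"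
    unfolding q_def sum_distrib_left
    by (rule sum.cong) (simp_all only: r mult_ac)
  also have "(\<Sum>i<n. of_padic_int (c i) * ?p ^ (n - i)) = of_padic_int (of_nat CARD('p) * a)"
    unfolding a_def sum_distrib_left padic.hom_sum
  proof (rule sum.cong)
    fix i assume "i \<in> {..<n}"
    then have "n - i = Suc (n - 1 - i)" by simp
    then show "of_padic_int (c i) * ?p ^ (n - i)
        = of_padic_int (of_nat CARD('p) * (c i * of_nat CARD('p) ^ (n - 1 - i)))"
      by (simp add: padic.hom_mult padic.hom_power)
  qed simp
  finally have "1 - of_padic_int (of_nat CARD('p) * a) = (1 - t ^ n) - (1 - t) * q"
    by simp
  also have "\<dots> = (1 - t) * (r n - q)"
    by (simp only: r right_diff_distrib)
  finally have eq: "of_padic_int (1 - of_nat CARD('p) * a) = (1 - t) * (r n - q)"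
    by (simp add: padic.hom_minus)
  have "Rep_padic_int (1 - of_nat CARD('p) * a) 1 = 1"
    using card_gt_1[where 'p='p]
    by (simp add: minus_padic_int.rep_eq one_padic_int.rep_eq times_padic_int.rep_eq
      Rep_padic_int_of_nat)
  then have "int_unit ((1 - t) * (r n - q))"
    unfolding eq[symmetric] by (intro int_unit_of_padic_int) (simp add: padic_int_unit_iff)
  then have "int_unit (1 - t)"
    by (rule int_unit_factor)
      (use t in \<open>auto simp: q_def r_def intro!: integral_diff integral_sum integral_mult padic.integral_hom\<close>)
  then show ?thesis by (simp add: t_def)
qed

text \<open>For w = 1 / p the element 1 - p w is 0, which is no unit. This is what makes the
  valuation below nontrivial.\<close>

lemma not_integral_inverse_prime:
  "\<not> padic.integral (inverse (of_nat CARD('p)) :: 'p::prime_card padic alg_closure)"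
  using int_unit_one_minus_prime_mult[of "inverse (of_nat CARD('p)) :: 'p padic alg_closure"]
  by (auto simp: int_unit_def)

lemma integral_prime_powi_iff:
  "padic.integral (of_nat CARD('p) powi n :: 'p::prime_card padic alg_closure) \<longleftrightarrow> n \<ge> 0"
proof
  let ?p = "of_nat CARD('p) :: 'p padic alg_closure"
  assume int: "padic.integral (?p powi n)"
  show "n \<ge> 0"
  proof (rule ccontr)
    assume "\<not> n \<ge> 0"
    then have "inverse ?p = ?p ^ nat (- n - 1) * ?p powi n"
      by (simp add: power_int_def field_simps flip: power_Suc)
        (metis Suc_nat_eq_nat_zadd1 add.commute diff_add_cancel linorder_not_le
          minus_less_iff neg_0_less_iff_less order_less_imp_le power_Suc zle_diff1_eq)
    then show False
      using int not_integral_inverse_prime[where 'p='p] by (metis integral_mult integral_of_nat integral_power)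
  qed
next
  assume "n \<ge> 0"
  then show "padic.integral (of_nat CARD('p) powi n :: 'p padic alg_closure)"
    by (auto simp: power_int_def)
qed

text \<open>The valuation normalised by \<open>v(p) = 1\<close>. It is not shown to be defined on the whole
  algebraic closure: \<open>has_val x q\<close> says that it is defined at \<open>x\<close> with the value \<open>q\<close>.\<close>

definition has_val :: "'p::prime_card padic alg_closure \<Rightarrow> rat \<Rightarrow> bool" where
  "has_val x q \<longleftrightarrow> (\<exists>d n. d > 0 \<and> q = of_int n / of_nat d \<and> int_unit (x ^ d / of_nat CARD('p) powi n))"

lemma has_valE:
  fixes x :: "'p::prime_card padic alg_closure"
  assumes "has_val x q"
  obtains d n u where "d > 0" "q = of_int n / of_nat d" "int_unit u" "x ^ d = of_nat CARD('p) powi n * u"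
proof -
  obtain d n where dn: "d > 0" "q = of_int n / of_nat d" "int_unit (x ^ d / of_nat CARD('p) powi n)"
    using assms unfolding has_val_def by blast
  show ?thesis by (rule that[OF dn]) simp
qed

lemma has_valI:
  fixes x :: "'p::prime_card padic alg_closure"
  assumes "d > 0" "q = of_int n / of_nat d" "int_unit u" "x ^ d = of_nat CARD('p) powi n * u"
  shows "has_val x q"
  unfolding has_val_def using assms by (intro exI[of _ d] exI[of _ n]) simp

lemma has_val_nonzero: "has_val x q \<Longrightarrow> x \<noteq> 0"
  by (auto simp: has_val_def int_unit_def power_0_left)

lemma has_val_unit: "int_unit u \<Longrightarrow> has_val u 0"
  by (rule has_valI[of 1 _ 0 u]) auto

lemma has_val_prime [simp]: "has_val (of_nat CARD('p) :: 'p::prime_card padic alg_closure) 1"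
  by (rule has_valI[of 1 _ 1 1]) auto

lemma has_val_mult [intro]:
  assumes "has_val x q" "has_val y r"
  shows "has_val (x * y) (q + r)"
proof -
  let ?p = "of_nat CARD('a) :: 'a padic alg_closure"
  obtain d n u where d: "d > 0" "q = of_int n / of_nat d" "int_unit u" "x ^ d = ?p powi n * u"
    using has_valE[OF assms(1)] .
  obtain e m v where e: "e > 0" "r = of_int m / of_nat e" "int_unit v" "y ^ e = ?p powi m * v"
    using has_valE[OF assms(2)] .
  show ?thesis
  proof (rule has_valI)
    show "d * e > 0" using d e by simp
    show "q + r = of_int (n * int e + m * int d) / of_nat (d * e)"
      using d e by (simp add: field_simps)
    show "int_unit (u ^ e * v ^ d)" using d e by auto
    have "(x * y) ^ (d * e) = (x ^ d) ^ e * (y ^ e) ^ d"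
      by (simp add: power_mult_distrib mult.commute flip: power_mult)
    also have "\<dots> = ?p powi (n * int e + m * int d) * (u ^ e * v ^ d)"
      by (simp add: d e power_mult_distrib power_int_add power_int_mult)
    finally show "(x * y) ^ (d * e) = ?p powi (n * int e + m * int d) * (u ^ e * v ^ d)" .
  qed
qed

lemma has_val_inverse:
  assumes "has_val x q"
  shows "has_val (inverse x) (- q)"
proof -
  obtain d n u where d: "d > 0" "q = of_int n / of_nat d" "int_unit u" "x ^ d = of_nat CARD('a) powi n * u"
    using has_valE[OF assms(1)] .
  show ?thesis
    by (rule has_valI[of d _ "- n" "inverse u"])
      (use d in \<open>auto simp: power_inverse power_int_minus\<close>)
qed

lemma has_val_divide: "has_val x q \<Longrightarrow> has_val y r \<Longrightarrow> has_val (x / y) (q - r)"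
  using has_val_mult[OF _ has_val_inverse, of x q y r] by (simp add: divide_inverse)

lemma has_val_power: "has_val x q \<Longrightarrow> has_val (x ^ n) (of_nat n * q)"
  by (induction n) (auto simp: algebra_simps has_val_unit dest: has_val_mult)

lemma has_val_mult_unit: "has_val x q \<Longrightarrow> int_unit u \<Longrightarrow> has_val (x * u) q"
  using has_val_mult[OF _ has_val_unit] by fastforce

lemma has_val_uminus: "has_val x q \<Longrightarrow> has_val (- x) q"
  using has_val_mult_unit[of x q "-1"] by auto

lemma has_val_root:
  assumes "has_val (x ^ k) q" "k > 0"
  shows "has_val x (q / of_nat k)"
proof -
  obtain d n u where d: "d > 0" "q = of_int n / of_nat d" "int_unit u"
      "(x ^ k) ^ d = of_nat CARD('a) powi n * u"
    using has_valE[OF assms(1)] .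
  show ?thesis
    by (rule has_valI[of "k * d" _ n u]) (use d assms(2) in \<open>simp_all add: power_mult\<close>)
qed

text \<open>Integrality is insensitive to passing to x^d and to unit factors, which leaves a power
  of p. Through this lemma estimates of values become statements on integrality and back.\<close>

lemma has_val_integral_iff:
  assumes "has_val x q"
  shows "padic.integral x \<longleftrightarrow> q \<ge> 0"
proof -
  let ?p = "of_nat CARD('a) :: 'a padic alg_closure"
  obtain d n u where d: "d > 0" "q = of_int n / of_nat d" "int_unit u" "x ^ d = ?p powi n * u"
    using has_valE[OF assms(1)] .
  have "padic.integral x \<longleftrightarrow> padic.integral (x ^ d)"
    using padic.integral_root[of x d] d(1) by blast
  also have "\<dots> \<longleftrightarrow> padic.integral (?p powi n)"
  proof
    assume "padic.integral (x ^ d)"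
    then have "padic.integral (x ^ d * inverse u)" using d(3) by (auto simp: int_unit_def)
    then show "padic.integral (?p powi n)" using d(3,4) by (auto simp: int_unit_def mult.assoc)
  qed (use d in \<open>auto simp: int_unit_def\<close>)
  also have "\<dots> \<longleftrightarrow> q \<ge> 0"
    using d(1,2) by (simp add: integral_prime_powi_iff zero_le_divide_iff)
  finally show ?thesis .
qed

lemma has_val_unit_iff: "has_val x q \<Longrightarrow> int_unit x \<longleftrightarrow> q = 0"
  using has_val_integral_iff[of x q] has_val_integral_iff[OF has_val_inverse, of x q] has_val_nonzero[of x q]
  by (auto simp: int_unit_def)

text \<open>The unit x / x has the value q - r, and units have the value 0.\<close>

lemma has_val_unique: "has_val x q \<Longrightarrow> has_val x r \<Longrightarrow> q = r"
  using has_val_unit_iff[OF has_val_divide, of x q x r] has_val_nonzero[of x q] by simp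

lemma integral_if_val_le:
  assumes "has_val x q" "has_val y r" "q \<le> r"
  shows "padic.integral (y / x)"
  using has_val_integral_iff[OF has_val_divide[OF assms(2,1)]] assms(3) by simp

text \<open>The assumption replaces a positive value of x, which need not be known: some power of x
  is an integral multiple of an r of positive value. A higher power is then p times an integral v,
  and 1 - x divides the unit 1 - p v.\<close>

lemma int_unit_one_minus_if_power:
  assumes "has_val r q" "q > 0" "x ^ k = r * w" "k > 0" "padic.integral w"
  shows "int_unit (1 - x)"
proof -
  let ?p = "of_nat CARD('a) :: 'a padic alg_closure"
  obtain d n u where d: "d > 0" "q = of_int n / of_nat d" "int_unit u" "r ^ d = ?p powi n * u"
    using has_valE[OF assms(1)] .
  have n: "n > 0" using assms(2) d(1,2) by (simp add: zero_less_divide_iff)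
  then have pn: "?p powi n = ?p * ?p ^ (nat n - 1)"
    by (simp add: power_int_def flip: power_Suc)
  define v where "v = ?p ^ (nat n - 1) * u * w ^ d"
  have v: "padic.integral v" using d(3) assms(5) by (auto simp: v_def int_unit_def)
  have xkd: "x ^ (k * d) = ?p * v"
    by (simp add: power_mult assms(3) power_mult_distrib d(4) pn v_def mult.assoc)
  then have "int_unit (1 - x ^ (k * d))"
    using int_unit_one_minus_prime_mult[OF v] by simp
  moreover have "padic.integral x"
    by (rule padic.integral_root[of _ "k * d"]) (use xkd v assms(4) d(1) in auto)
  ultimately show ?thesis
    using int_unit_factor[of "1 - x" "\<Sum>j<k * d. x ^ j"] by (auto simp: one_diff_power_eq)
qed

lemma int_unit_one_minus:
  assumes "has_val x q" "q > 0"
  shows "int_unit (1 - x)"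
  by (rule int_unit_one_minus_if_power[OF assms, of x 1 1]) simp_all

text \<open>In x + y = x (1 + y / x) the quotient y / x has positive value, so the second factor is
  a unit.\<close>

lemma has_val_add_less:
  assumes "has_val x q" "has_val y r" "q < r"
  shows "has_val (x + y) q"
proof -
  have "int_unit (1 - (- y / x))"
    using has_val_divide[OF has_val_uminus[OF assms(2)] assms(1)] assms(3)
    by (intro int_unit_one_minus) auto
  then have "has_val (x * (1 - (- y / x))) q"
    using assms(1) by (intro has_val_mult_unit)
  then show ?thesis
    using has_val_nonzero[OF assms(1)] by (simp add: algebra_simps)
qed

text \<open>The term of least value dominates the sum. The minimality is recorded because it makes
  each term of an integral sum integral.\<close>

lemma has_val_sum_distinct:
  assumes "finite A" "A \<noteq> {}" "\<And>i. i \<in> A \<Longrightarrow> has_val (t i) (q i)" "inj_on q A"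
  shows "\<exists>i\<in>A. has_val (\<Sum>i\<in>A. t i) (q i) \<and> (\<forall>j\<in>A. q i \<le> q j)"
  using assms
proof (induction A rule: finite_ne_induct)
  case (insert a A)
  then obtain i where i: "i \<in> A" "has_val (\<Sum>i\<in>A. t i) (q i)" "\<forall>j\<in>A. q i \<le> q j"
    by (auto simp: inj_on_def)
  have "q a \<noteq> q i" using i(1) insert by (auto simp: inj_on_def)
  then consider "q a < q i" | "q i < q a" by linarith
  then show ?case
  proof cases
    case 1
    then have "has_val (t a + (\<Sum>i\<in>A. t i)) (q a)"
      using i insert by (intro has_val_add_less) auto
    then show ?thesis using 1 i insert by force
  next
    case 2
    then have "has_val ((\<Sum>i\<in>A. t i) + t a) (q i)"
      using i insert by (intro has_val_add_less) auto
    then show ?thesis using 2 i insert by (auto simp: add.commute)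
  qed
qed auto

section \<open>Comparison with the valuation of the p-adic numbers\<close>

lemma padic_decompose:
  assumes "(x :: 'p::prime_card padic) \<noteq> 0"
  obtains k and u :: "'p::prime_card padic_int" where "u dvd 1" "x = of_nat CARD('p) powi k * Fract u 1"
proof -
  let ?P = "of_nat CARD('p) :: 'p padic"
  obtain a b where ab: "x = Fract a b" "b \<noteq> 0" by (cases x) auto
  then have "a \<noteq> 0" using assms by (auto simp: Zero_fract_def eq_fract)
  then obtain k u where a: "u dvd 1" "a = of_nat CARD('p) ^ k * u"
    using padic_int_decompose by blast
  obtain l v where b: "v dvd 1" "b = of_nat CARD('p) ^ l * v"
    using padic_int_decompose[OF ab(2)] by blast
  obtain w where w: "v * w = 1" using b(1) by (metis dvdE)
  have pow: "Fract (of_nat CARD('p) ^ n :: 'p padic_int) 1 = ?P ^ n" for n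
    by (metis of_nat_fract of_nat_power)
  have P: "?P \<noteq> 0"
    by (metis prime_num_neq_0 to_ac_0 to_ac_of_nat)
  have "x * ?P ^ l = Fract a b * Fract (of_nat CARD('p) ^ l) 1"
    by (simp add: ab(1) pow)
  also have "\<dots> = Fract (of_nat CARD('p) ^ k) 1 * Fract (u * w) 1"
    using w ab(2) by (simp add: eq_fract) (simp add: a b mult_ac)
  finally have "x = ?P powi (int k - int l) * Fract (u * w) 1"
    using P by (simp add: pow power_int_diff field_simps)
  moreover have "u * w dvd 1"
    using a(1) w by (metis dvd_triv_right mult_dvd_mono mult_1)
  ultimately show ?thesis using that by blast
qed

lemma has_val_to_ac:
  fixes x :: "'p::prime_card padic"
  assumes "x \<noteq> 0"
  shows "has_val (to_ac x) (of_int (padic_val x))"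
proof -
  obtain k and u :: "'p padic_int" where u: "u dvd 1" and x: "x = of_nat CARD('p) powi k * Fract u 1"
    using padic_decompose[OF assms] .
  have "to_ac (of_nat CARD('p) powi k :: 'p padic) = of_nat CARD('p) powi k"
    by (simp add: power_int_def)
  then have "to_ac x ^ 1 = of_nat CARD('p) powi k * of_padic_int u"
    by (simp add: x of_padic_int_def)
  then show ?thesis
    using has_valI[of 1 "of_int k" k "of_padic_int u" "to_ac x"] padic_val_eqI[OF u x]
      int_unit_of_padic_int[OF u] by simp
qed

section \<open>Subfields of a field type and simple extensions\<close>

lemma ring_of_type_algebra_simps [simp]:
  "carrier (ring_of_type_algebra :: 'a::field ring) = UNIV"
  "x \<oplus>\<^bsub>ring_of_type_algebra\<^esub> y = x + y"
  "x \<otimes>\<^bsub>ring_of_type_algebra\<^esub> y = x * y"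
  "\<zero>\<^bsub>ring_of_type_algebra :: 'a ring\<^esub> = 0"
  "\<one>\<^bsub>ring_of_type_algebra :: 'a ring\<^esub> = 1"
  by (simp_all add: ring_of_type_algebra_def)

lemma a_inv_type_algebra [simp]: "\<ominus>\<^bsub>ring_of_type_algebra\<^esub> x = - (x :: 'a::field)"
  using abelian_group.minus_equality[OF ring.is_abelian_group[OF ring_from_type_algebra], of "- x" x] by simp

lemma m_inv_type_algebra [simp]: "x \<noteq> 0 \<Longrightarrow> inv\<^bsub>ring_of_type_algebra\<^esub> x = inverse (x :: 'a::field)"
  using comm_monoid.comm_inv_char[OF cring.axioms(2)[OF cring_from_type_algebra], of x "inverse x"] by simp

lemma subfield_type_algebraI:
  fixes K :: "'a::field set"
  assumes "1 \<in> K" "\<And>x y. x \<in> K \<Longrightarrow> y \<in> K \<Longrightarrow> x + y \<in> K" "\<And>x. x \<in> K \<Longrightarrow> - x \<in> K"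
    "\<And>x y. x \<in> K \<Longrightarrow> y \<in> K \<Longrightarrow> x * y \<in> K" "\<And>x. x \<in> K \<Longrightarrow> x \<noteq> 0 \<Longrightarrow> inverse x \<in> K"
  shows "subfield K ring_of_type_algebra"
  by (rule field.subfieldI'[OF field_from_type_algebra], rule ring.subringI[OF ring_from_type_algebra]) (use assms in auto)

lemma poly_mod_root:
  assumes "poly m x = 0"
  shows "poly (f mod m) x = poly f x"
proof -
  have "poly f x = poly (f div m * m + f mod m) x" by (simp only: div_mult_mod_eq)
  then show ?thesis using assms by (simp only: poly_add poly_mult) simp
qed

locale type_subfield =
  fixes K :: "'a::field set"
  assumes subfield: "subfield K ring_of_type_algebra"
begin

lemma one_mem [simp]: "1 \<in> K"
  and zero_mem [simp]: "0 \<in> K"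
  and add_mem [intro]: "x \<in> K \<Longrightarrow> y \<in> K \<Longrightarrow> x + y \<in> K"
  and mult_mem [intro]: "x \<in> K \<Longrightarrow> y \<in> K \<Longrightarrow> x * y \<in> K"
  and uminus_mem [intro]: "x \<in> K \<Longrightarrow> - x \<in> K"
  using subringE(2-3)[OF subfieldE(1)[OF subfield]] subringE(5)[OF subfieldE(1)[OF subfield], of x]
    subringE(6,7)[OF subfieldE(1)[OF subfield], of x y] by simp_all

lemma diff_mem [intro]: "x \<in> K \<Longrightarrow> y \<in> K \<Longrightarrow> x - y \<in> K"
  using add_mem[of x "- y"] by auto

lemma inverse_mem [intro]: "x \<in> K \<Longrightarrow> inverse x \<in> K"
  using ring.subfield_m_inv(1)[OF ring_from_type_algebra subfield, of x] by (cases "x = 0") auto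

lemma divide_mem [intro]: "x \<in> K \<Longrightarrow> y \<in> K \<Longrightarrow> x / y \<in> K"
  by (auto simp: divide_inverse)

lemma power_mem [intro]: "x \<in> K \<Longrightarrow> x ^ n \<in> K"
  by (induction n) auto

lemma sum_mem: "(\<And>i. i \<in> A \<Longrightarrow> f i \<in> K) \<Longrightarrow> (\<Sum>i\<in>A. f i) \<in> K"
  by (induction A rule: infinite_finite_induct) auto

lemma of_nat_mem [simp]: "of_nat n \<in> K"
  by (induction n) auto

section \<open>Polynomials over a subfield\<close>

definition poly_over :: "'a poly \<Rightarrow> bool" where
  "poly_over f \<longleftrightarrow> (\<forall>n. Polynomial.coeff f n \<in> K)"

lemma poly_over_coeff: "poly_over f \<Longrightarrow> Polynomial.coeff f n \<in> K"
  by (simp add: poly_over_def)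

lemma poly_over_0 [simp]: "poly_over 0"
  by (simp add: poly_over_def)

lemma poly_over_pCons [simp]: "poly_over (pCons a f) \<longleftrightarrow> a \<in> K \<and> poly_over f"
  unfolding poly_over_def
proof safe
  assume *: "\<forall>n. Polynomial.coeff (pCons a f) n \<in> K"
  show "a \<in> K" using *[rule_format, of 0] by simp
  show "Polynomial.coeff f n \<in> K" for n using *[rule_format, of "Suc n"] by simp
qed (simp add: coeff_pCons split: nat.split)

lemma poly_over_1 [simp]: "poly_over 1"
  by (simp add: one_pCons)

lemma poly_over_add [intro]: "poly_over f \<Longrightarrow> poly_over g \<Longrightarrow> poly_over (f + g)"
  and poly_over_diff [intro]: "poly_over f \<Longrightarrow> poly_over g \<Longrightarrow> poly_over (f - g)"
  and poly_over_uminus [intro]: "poly_over f \<Longrightarrow> poly_over (- f)"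
  and poly_over_smult [intro]: "a \<in> K \<Longrightarrow> poly_over f \<Longrightarrow> poly_over (Polynomial.smult a f)"
  by (auto simp: poly_over_def)

lemma poly_over_monom [intro]: "a \<in> K \<Longrightarrow> poly_over (Polynomial.monom a n)"
  by (auto simp: poly_over_def)

lemma poly_over_mult [intro]: "poly_over f \<Longrightarrow> poly_over g \<Longrightarrow> poly_over (f * g)"
  by (auto simp: poly_over_def coeff_mult intro!: sum_mem)

lemma poly_over_pcompose [intro]:
  assumes "poly_over f" "poly_over g"
  shows "poly_over (f \<circ>\<^sub>p g)"
  using assms(1)
  by (induction f) (use assms(2) in \<open>auto simp: pcompose_pCons simp del: mult_pCons_left\<close>)

text \<open>Long division by m divides only by its leading coefficient, which lies in the field
  \<open>K\<close>.\<close>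

lemma poly_over_div_mod:
  assumes "poly_over f" "poly_over m"
  shows "poly_over (f div m)" "poly_over (f mod m)"
proof -
  have "poly_over (f div m) \<and> poly_over (f mod m)"
    using assms(1)
  proof (induction f)
    case (pCons a f)
    then have IH: "poly_over (f div m)" "poly_over (f mod m)" "a \<in> K" by auto
    then have "Polynomial.coeff (pCons a (f mod m)) (Polynomial.degree m) / Polynomial.lead_coeff m \<in> K"
      using assms(2) by (intro divide_mem poly_over_coeff) auto
    then show ?case
      using IH pCons.prems assms(2) by (auto simp: div_pCons_eq mod_pCons_eq)
  qed simp
  then show "poly_over (f div m)" "poly_over (f mod m)" by auto
qed

lemma poly_mem: "poly_over f \<Longrightarrow> x \<in> K \<Longrightarrow> poly f x \<in> K"
  by (induction f) auto

text \<open>The ring K[x] of polynomial expressions, without quotients. It is a field once x is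
  algebraic over \<open>K\<close>, by \<open>adjoin_subfield\<close>.\<close>

definition adjoin :: "'a \<Rightarrow> 'a set" where
  "adjoin x = {poly f x | f. poly_over f}"

lemma adjoinI: "poly_over f \<Longrightarrow> poly f x \<in> adjoin x"
  unfolding adjoin_def by blast

lemma adjoinE:
  assumes "y \<in> adjoin x"
  obtains f where "poly_over f" "y = poly f x"
  using assms unfolding adjoin_def by blast

lemma subset_adjoin: "K \<subseteq> adjoin x"
proof
  fix k assume "k \<in> K"
  then show "k \<in> adjoin x" using adjoinI[of "[:k:]" x] by simp
qed

lemma mem_adjoin: "x \<in> adjoin x"
  using adjoinI[of "[:0, 1:]" x] by simp

lemma adjoin_reduced:
  assumes "poly_over m" "poly m x = 0" "Polynomial.degree m > 0" "y \<in> adjoin x"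
  obtains f where "poly_over f" "y = poly f x" "Polynomial.degree f < Polynomial.degree m"
proof -
  obtain g where g: "poly_over g" "y = poly g x" using adjoinE[OF assms(4)] .
  have "y = poly (g mod m) x" using g(2) assms(2) by (simp add: poly_mod_root)
  moreover have "m \<noteq> 0" using assms(3) by auto
  then have "Polynomial.degree (g mod m) < Polynomial.degree m"
    using assms(3) degree_mod_less' by (cases "g mod m = 0") auto
  ultimately show ?thesis using poly_over_div_mod(2)[OF g(1) assms(1)] that by blast
qed

text \<open>Inverses come from division with remainder of an annihilator of \<open>x\<close> of least degree.\<close>

lemma adjoin_subfield:
  assumes "poly_over m" "poly m x = 0" "m \<noteq> 0"
  shows "subfield (adjoin x) ring_of_type_algebra"
proof -
  define Ann where "Ann f \<longleftrightarrow> f \<noteq> 0 \<and> poly_over f \<and> poly f x = 0" for f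
  define m' where "m' = arg_min Polynomial.degree Ann"
  have "Ann m" using assms by (simp add: Ann_def)
  then have m': "Ann m'" unfolding m'_def by (rule arg_min_natI)
  have min: "Polynomial.degree m' \<le> Polynomial.degree f" if "Ann f" for f
    unfolding m'_def using that by (rule arg_min_nat_le)
  have inv: "\<exists>g. poly_over g \<and> poly f x * poly g x = 1"
    if "poly_over f" "f \<noteq> 0" "Polynomial.degree f < Polynomial.degree m'" for f
    using that
  proof (induction "Polynomial.degree f" arbitrary: f rule: less_induct)
    case less
    show ?case
    proof (cases "Polynomial.degree f = 0")
      case True
      then obtain a where a: "f = [:a:]" using degree_eq_zeroE by blast
      then have "a \<in> K" "a \<noteq> 0" using less.prems by auto
      then show ?thesis by (intro exI[of _ "[:inverse a:]"]) (auto simp: a)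
    next
      case False
      let ?q = "m' div f" and ?r = "m' mod f"
      have over: "poly_over ?q" "poly_over ?r"
        using poly_over_div_mod less.prems m' by (auto simp: Ann_def)
      have "poly (?q * f + ?r) x = 0" using m' by (simp add: Ann_def)
      \<comment> \<open>Division of m' by f, evaluated at x: an inverse of the remainder at x, which
        the induction provides, yields an inverse of f(x).\<close>
      then have eq: "poly f x * poly (- ?q) x = poly ?r x"
        by (simp only: poly_add poly_mult poly_minus) (simp add: add_eq_0_iff mult.commute)
      \<comment> \<open>Otherwise f or the quotient would annihilate x, and both have smaller degree
        than m'.\<close>
      have "?r \<noteq> 0"
      proof
        assume r0: "?r = 0"
        then have m'_eq: "m' = ?q * f" by (metis add.right_neutral div_mult_mod_eq)
        then have "?q \<noteq> 0" using m' by (auto simp: Ann_def)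
        then have "Polynomial.degree m' = Polynomial.degree ?q + Polynomial.degree f"
          using less.prems(2) m'_eq Polynomial.degree_mult_eq by metis
        then have lt: "Polynomial.degree ?q < Polynomial.degree m'" using False by simp
        then have "\<not> Ann ?q" using min[of ?q] by auto
        moreover have "\<not> Ann f" using min[of f] less.prems(3) by auto
        ultimately show False
          using eq r0 over(1) \<open>?q \<noteq> 0\<close> less.prems(1,2) by (simp add: Ann_def)
      qed
      moreover have lt: "Polynomial.degree ?r < Polynomial.degree f"
        using \<open>?r \<noteq> 0\<close> less.prems(2) degree_mod_less' by blast
      ultimately obtain g where g: "poly_over g" "poly ?r x * poly g x = 1"
        using less.hyps[of ?r] over(2) less.prems(3) by auto
      have "poly f x * poly (- ?q * g) x = 1"
        using g(2) unfolding eq[symmetric] by (simp only: poly_mult mult.assoc)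
      moreover have "poly_over (- ?q * g)" using over g(1) by auto
      ultimately show ?thesis by blast
    qed
  qed
  show ?thesis
  proof (rule subfield_type_algebraI)
    show "1 \<in> adjoin x" using subset_adjoin one_mem by blast
    fix y assume y: "y \<in> adjoin x"
    then obtain f where f: "poly_over f" "y = poly f x" by (rule adjoinE)
    show "- y \<in> adjoin x" using adjoinI[of "- f" x] f by auto
    show "inverse y \<in> adjoin x" if "y \<noteq> 0"
    proof -
      have y_eq: "y = poly (f mod m') x"
        using f(2) m' by (simp add: Ann_def poly_mod_root)
      then have nz: "f mod m' \<noteq> 0" using that by auto
      moreover have "Polynomial.degree (f mod m') < Polynomial.degree m'"
        using nz m' degree_mod_less' unfolding Ann_def by blast
      ultimately obtain g where g: "poly_over g" "poly (f mod m') x * poly g x = 1"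
        using inv[of "f mod m'"] poly_over_div_mod(2)[OF f(1)] m' by (auto simp: Ann_def)
      then have "inverse y = poly g x" using y_eq by (metis inverse_unique)
      then show ?thesis using adjoinI[OF g(1)] by simp
    qed
    fix z assume "z \<in> adjoin x"
    then obtain g where g: "poly_over g" "z = poly g x" by (rule adjoinE)
    show "y + z \<in> adjoin x" using adjoinI[of "f + g" x] f g by auto
    show "y * z \<in> adjoin x" using adjoinI[of "f * g" x] f g by auto
  qed
qed

lemma adjoin_least:
  assumes "subfield E ring_of_type_algebra" "K \<subseteq> E" "x \<in> E"
  shows "adjoin x \<subseteq> E"
proof
  interpret E: type_subfield E by (rule type_subfield.intro) (rule assms(1))
  fix y assume "y \<in> adjoin x"
  then obtain f where f: "poly_over f" "y = poly f x" by (rule adjoinE)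
  then show "y \<in> E"
    using E.poly_mem[of f x] assms(2,3) by (auto simp: E.poly_over_def poly_over_def)
qed

end

lemma Qp_adjoin_subfield: "subfield (Qp_adjoin S) ring_of_type_algebra"
  unfolding Qp_adjoin_def by (rule field.generate_field_is_subfield[OF field_from_type_algebra]) simp

lemma Qp_adjoin_superset: "range to_ac \<subseteq> Qp_adjoin S" "S \<subseteq> Qp_adjoin S"
  unfolding Qp_adjoin_def by (auto intro: generate_field.incl)

lemma Qp_adjoin_least:
  "subfield E ring_of_type_algebra \<Longrightarrow> range to_ac \<subseteq> E \<Longrightarrow> S \<subseteq> E \<Longrightarrow> Qp_adjoin S \<subseteq> E"
  unfolding Qp_adjoin_def by (rule field.generate_field_min_subfield1[OF field_from_type_algebra]) auto

lemma subfield_range_to_ac: "subfield (range to_ac) (ring_of_type_algebra :: 'a::field alg_closure ring)"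
proof (rule subfield_type_algebraI)
  show "1 \<in> range (to_ac :: 'a \<Rightarrow> _)" by (rule range_eqI[of _ _ 1]) simp
qed (auto simp flip: to_ac_add to_ac_minus to_ac_mult to_ac_inverse)

text \<open>Leads from generated fields, in which the tower is stated, to polynomial expressions in
  one generator, on which the Kummer theory is built.\<close>

lemma Qp_adjoin_insert:
  assumes "type_subfield.poly_over (Qp_adjoin S) m" "poly m x = 0" "m \<noteq> 0"
  shows "Qp_adjoin (insert x S) = type_subfield.adjoin (Qp_adjoin S) x"
proof -
  interpret type_subfield "Qp_adjoin S" by (rule type_subfield.intro) (rule Qp_adjoin_subfield)
  show ?thesis
  proof
    show "Qp_adjoin (insert x S) \<subseteq> adjoin x"
      using subset_adjoin[of x] Qp_adjoin_superset[of S] mem_adjoin[of x] adjoin_subfield[OF assms]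
      by (intro Qp_adjoin_least) auto
    show "adjoin x \<subseteq> Qp_adjoin (insert x S)"
      using Qp_adjoin_superset[of "insert x S"]
      by (intro adjoin_least Qp_adjoin_least Qp_adjoin_subfield) auto
  qed
qed

section \<open>Kummer extensions\<close>

lemma on_carrier_simps [simp]:
  "carrier (on_carrier A) = A" "x \<otimes>\<^bsub>on_carrier A\<^esub> y = x * y" "x \<oplus>\<^bsub>on_carrier A\<^esub> y = x + y"
  "\<one>\<^bsub>on_carrier A\<^esub> = 1" "\<zero>\<^bsub>on_carrier A\<^esub> = 0"
  by (simp_all add: on_carrier_def ring_of_type_algebra_def)

text \<open>The assumption \<open>indep\<close> is the linear independence of 1, \<beta>, ...,
  \<beta>^(p - 1) over \<open>K\<close>. It takes the place of the irreducibility of X^p - \<beta>^p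
  and is the form in which valuations can supply it.\<close>

locale kummer_extension = type_subfield K
  for K :: "'a::field set" +
  fixes \<zeta> \<beta> :: 'a and p :: nat
  assumes p_gt_1: "p > 1"
    and root: "primitive_root_of_unity p \<zeta>" and zeta_mem: "\<zeta> \<in> K"
    and beta_power_mem: "\<beta> ^ p \<in> K"
    and indep: "\<And>f. poly_over f \<Longrightarrow> Polynomial.degree f < p \<Longrightarrow> poly f \<beta> = 0 \<Longrightarrow> f = 0"
begin

lemma p_gt_0: "p > 0"
  using p_gt_1 by simp

lemma zeta_power_p [simp]: "\<zeta> ^ p = 1"
  using root by (simp add: primitive_root_of_unity_def)

lemma zeta_nonzero: "\<zeta> \<noteq> 0"
  using zeta_power_p p_gt_0 by (metis power_0_left zero_neq_one less_numeral_extra(3))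

lemma beta_nonzero: "\<beta> \<noteq> 0"
  using indep[of "[:0, 1:]"] p_gt_1 by auto

lemma zeta_power_mod: "\<zeta> ^ (j mod p) = \<zeta> ^ j"
proof -
  have "\<zeta> ^ j = \<zeta> ^ (p * (j div p) + j mod p)" by simp
  then show ?thesis unfolding power_add power_mult by simp
qed

lemma inj_zeta_power: "inj_on (\<lambda>j. \<zeta> ^ j) {..<p}"
proof (rule linorder_inj_onI)
  fix i j assume "i < j" "i \<in> {..<p}" "j \<in> {..<p}"
  then have "\<zeta> ^ (j - i) \<noteq> 1"
    using root by (auto simp: primitive_root_of_unity_def)
  moreover have "\<zeta> ^ j = \<zeta> ^ i * \<zeta> ^ (j - i)"
    using \<open>i < j\<close> by (simp flip: power_add)
  ultimately show "\<zeta> ^ i \<noteq> \<zeta> ^ j" using zeta_nonzero by auto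
qed auto

text \<open>The powers of \<zeta> with exponent below p are p distinct roots of X^p - 1, which has
  at most p roots.\<close>

lemma root_of_unity_is_power:
  assumes "x ^ p = 1"
  obtains j where "j < p" "x = \<zeta> ^ j"
proof -
  let ?f = "Polynomial.monom 1 p + [:-1:] :: 'a poly"
  have deg: "Polynomial.degree ?f = p"
    using p_gt_0 by (subst degree_add_eq_left) (simp_all add: Polynomial.degree_monom_eq)
  then have "?f \<noteq> 0" using p_gt_0 by auto
  have fin: "finite {x. poly ?f x = 0}" by (rule poly_roots_finite[OF \<open>?f \<noteq> 0\<close>])
  have "card {x. poly ?f x = 0} \<le> p"
    using card_poly_roots_bound[OF \<open>?f \<noteq> 0\<close>] deg by simp
  moreover have sub: "(\<lambda>j. \<zeta> ^ j) ` {..<p} \<subseteq> {x. poly ?f x = 0}"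
    by (auto simp: poly_monom power_mult[symmetric] mult.commute[of _ p]) (simp add: power_mult)
  moreover have "card ((\<lambda>j. \<zeta> ^ j) ` {..<p}) = p"
    using card_image[OF inj_zeta_power] by simp
  ultimately have "(\<lambda>j. \<zeta> ^ j) ` {..<p} = {x. poly ?f x = 0}"
    using card_seteq[OF fin sub] by simp
  moreover have "poly ?f x = 0" using assms by (simp add: poly_monom)
  ultimately show ?thesis using that by blast
qed

definition kummer_poly :: "'a poly" where
  "kummer_poly = Polynomial.monom 1 p + [:- (\<beta> ^ p):]"

lemma kummer_poly:
  shows degree_kummer_poly: "Polynomial.degree kummer_poly = p"
    and poly_over_kummer_poly: "poly_over kummer_poly"
    and kummer_poly_nonzero: "kummer_poly \<noteq> 0"
    and poly_kummer_poly: "poly kummer_poly (\<zeta> ^ j * \<beta>) = 0"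
    and poly_kummer_poly_beta: "poly kummer_poly \<beta> = 0"
proof -
  show deg: "Polynomial.degree kummer_poly = p"
    unfolding kummer_poly_def
    using p_gt_0 by (subst degree_add_eq_left) (simp_all add: Polynomial.degree_monom_eq)
  show "kummer_poly \<noteq> 0" using deg p_gt_0 by auto
  show "poly_over kummer_poly"
    unfolding kummer_poly_def using beta_power_mem by (intro poly_over_add poly_over_monom) auto
  have "(\<zeta> ^ j) ^ p = (\<zeta> ^ p) ^ j" by (simp only: power_mult[symmetric] mult.commute)
  then have "(\<zeta> ^ j) ^ p = 1" by simp
  then show "poly kummer_poly (\<zeta> ^ j * \<beta>) = 0"
    by (simp add: kummer_poly_def poly_monom power_mult_distrib)
  show "poly kummer_poly \<beta> = 0" by (simp add: kummer_poly_def poly_monom)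
qed

abbreviation L where "L \<equiv> adjoin \<beta>"

lemma L_reduced:
  assumes "x \<in> L"
  obtains f where "poly_over f" "x = poly f \<beta>" "Polynomial.degree f < p"
  using adjoin_reduced[OF poly_over_kummer_poly poly_kummer_poly_beta _ assms] p_gt_0 degree_kummer_poly
  by metis

lemma L_subfield: "subfield L ring_of_type_algebra"
  by (rule adjoin_subfield[OF poly_over_kummer_poly poly_kummer_poly_beta kummer_poly_nonzero])

sublocale L: type_subfield L
  by (rule type_subfield.intro) (rule L_subfield)

text \<open>By \<open>indep\<close> the remainder of f modulo \<open>kummer_poly\<close> is 0, and
  every \<zeta>^j \<beta> is a root of \<open>kummer_poly\<close> too.\<close>

lemma poly_conj_eq_0:
  assumes "poly_over f" "poly f \<beta> = 0"
  shows "poly f (\<zeta> ^ j * \<beta>) = 0"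
proof -
  have "f mod kummer_poly = 0"
  proof (rule indep)
    show "poly_over (f mod kummer_poly)"
      by (rule poly_over_div_mod(2)[OF assms(1) poly_over_kummer_poly])
    show "Polynomial.degree (f mod kummer_poly) < p"
      using degree_mod_less'[OF kummer_poly_nonzero, of f] p_gt_0 degree_kummer_poly
      by (cases "f mod kummer_poly = 0") auto
    show "poly (f mod kummer_poly) \<beta> = 0"
      using assms(2) by (simp add: poly_mod_root[OF poly_kummer_poly_beta])
  qed
  then show ?thesis using poly_mod_root[OF poly_kummer_poly[of j], of f] by simp
qed

text \<open>The automorphism that sends \<beta> to \<zeta>^j \<beta>, computed on an arbitrary
  polynomial that represents x. By \<open>poly_conj_eq_0\<close> the result does not depend on the
  choice, see \<open>galois_conj_poly\<close>.\<close>

definition galois_conj :: "nat \<Rightarrow> 'a \<Rightarrow> 'a" where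
  "galois_conj j x = poly (SOME f. poly_over f \<and> poly f \<beta> = x) (\<zeta> ^ j * \<beta>)"

lemma galois_conj_poly:
  assumes "poly_over f"
  shows "galois_conj j (poly f \<beta>) = poly f (\<zeta> ^ j * \<beta>)"
proof -
  define g where "g = (SOME g. poly_over g \<and> poly g \<beta> = poly f \<beta>)"
  have g: "poly_over g \<and> poly g \<beta> = poly f \<beta>"
    unfolding g_def by (rule someI[of _ f]) (use assms in simp)
  then have "poly (g - f) (\<zeta> ^ j * \<beta>) = 0"
    using assms by (intro poly_conj_eq_0) auto
  then show ?thesis by (simp add: galois_conj_def g_def)
qed

text \<open>Conjugation substitutes \<zeta>^j X for X in the representing polynomial, and the
  coefficients stay in \<open>K\<close> because \<zeta> lies in \<open>K\<close>.\<close>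

lemma galois_conj_mem: "x \<in> L \<Longrightarrow> galois_conj j x \<in> L"
  and galois_conj_galois_conj: "x \<in> L \<Longrightarrow> galois_conj i (galois_conj j x) = galois_conj (i + j) x"
proof -
  assume "x \<in> L"
  then obtain f where f: "poly_over f" "x = poly f \<beta>" by (rule adjoinE)
  have over: "poly_over (f \<circ>\<^sub>p [:0, \<zeta> ^ j:])" using f(1) zeta_mem by (intro poly_over_pcompose) auto
  have eq: "galois_conj j x = poly (f \<circ>\<^sub>p [:0, \<zeta> ^ j:]) \<beta>"
    by (simp add: f(2) galois_conj_poly[OF f(1)] poly_pcompose mult.commute)
  show "galois_conj j x \<in> L" unfolding eq by (rule adjoinI[OF over])
  show "galois_conj i (galois_conj j x) = galois_conj (i + j) x"
    unfolding eq galois_conj_poly[OF over]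
    by (simp add: f(2) galois_conj_poly[OF f(1)] poly_pcompose power_add mult_ac)
qed

lemma galois_conj_add: "x \<in> L \<Longrightarrow> y \<in> L \<Longrightarrow> galois_conj j (x + y) = galois_conj j x + galois_conj j y"
  and galois_conj_mult: "x \<in> L \<Longrightarrow> y \<in> L \<Longrightarrow> galois_conj j (x * y) = galois_conj j x * galois_conj j y"
proof -
  assume "x \<in> L" "y \<in> L"
  then obtain f g where f: "poly_over f" "x = poly f \<beta>" and g: "poly_over g" "y = poly g \<beta>"
    by (metis adjoinE)
  show "galois_conj j (x + y) = galois_conj j x + galois_conj j y"
    using galois_conj_poly[OF poly_over_add[OF f(1) g(1)], of j]
    by (simp add: f g galois_conj_poly)
  show "galois_conj j (x * y) = galois_conj j x * galois_conj j y"
    using galois_conj_poly[OF poly_over_mult[OF f(1) g(1)], of j]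
    by (simp add: f g galois_conj_poly)
qed

lemma galois_conj_fixes: "x \<in> K \<Longrightarrow> galois_conj j x = x"
  using galois_conj_poly[of "[:x:]" j] by simp

lemma galois_conj_beta: "galois_conj j \<beta> = \<zeta> ^ j * \<beta>"
  using galois_conj_poly[of "[:0, 1:]" j] by simp

lemma galois_conj_uminus: "x \<in> L \<Longrightarrow> galois_conj j (- x) = - galois_conj j x"
  using galois_conj_mult[of "-1" x j] galois_conj_fixes[of "-1" j] L.uminus_mem[OF L.one_mem]
    uminus_mem[OF one_mem] by simp

lemma galois_conj_diff: "x \<in> L \<Longrightarrow> y \<in> L \<Longrightarrow> galois_conj j (x - y) = galois_conj j x - galois_conj j y"
  using galois_conj_add[of x "- y" j] galois_conj_uminus[of y j] L.uminus_mem[of y] by simp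

lemma galois_conj_power: "x \<in> L \<Longrightarrow> galois_conj j (x ^ n) = galois_conj j x ^ n"
  by (induction n) (simp_all add: galois_conj_fixes galois_conj_mult L.power_mem)

lemma galois_conj_sum:
  "(\<And>i. i \<in> A \<Longrightarrow> f i \<in> L) \<Longrightarrow> galois_conj j (\<Sum>i\<in>A. f i) = (\<Sum>i\<in>A. galois_conj j (f i))"
  by (induction A rule: infinite_finite_induct)
    (simp_all add: galois_conj_fixes galois_conj_add L.sum_mem)

lemma galois_conj_mod: "galois_conj (j mod p) x = galois_conj j x"
  by (simp add: galois_conj_def zeta_power_mod)

lemma galois_conj_0: "x \<in> L \<Longrightarrow> galois_conj 0 x = x"
  by (erule adjoinE) (simp add: galois_conj_poly)

lemma galois_conj_inverse:
  assumes "x \<in> L" "j \<le> p"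
  shows "galois_conj (p - j) (galois_conj j x) = x" "galois_conj j (galois_conj (p - j) x) = x"
  using assms galois_conj_galois_conj[OF assms(1)] galois_conj_mod[of p x]
  by (simp_all add: galois_conj_0)

text \<open>Comparing coefficients of f(\<zeta> X) and f(X), which independence allows, gives
  \<zeta>^n c = c for the n-th coefficient c. Since \<zeta>^n differs from 1 for 0 < n < p, only the
  constant term survives.\<close>

lemma galois_conj_1_fixed:
  assumes "x \<in> L" "galois_conj 1 x = x"
  shows "x \<in> K"
proof -
  obtain f where f: "poly_over f" "x = poly f \<beta>" "Polynomial.degree f < p"
    using L_reduced[OF assms(1)] .
  let ?g = "f \<circ>\<^sub>p [:0, \<zeta>:]"
  have "?g - f = 0"
  proof (rule indep)
    show "poly_over (?g - f)"
      using f(1) zeta_mem by (intro poly_over_diff poly_over_pcompose) auto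
    have "Polynomial.degree ?g \<le> Polynomial.degree f"
      using degree_pcompose_le[of f "[:0, \<zeta>:]"] by (simp split: if_splits)
    then show "Polynomial.degree (?g - f) < p"
      using f(3) by (intro degree_diff_less) auto
    show "poly (?g - f) \<beta> = 0"
      using assms(2) galois_conj_poly[OF f(1), of 1] by (simp add: f(2) poly_pcompose mult.commute)
  qed
  then have eq: "\<zeta> ^ n * Polynomial.coeff f n = Polynomial.coeff f n" for n
    using coeff_pcompose_linear[of f \<zeta> n] by simp
  have "Polynomial.coeff f n = 0" if "n > 0" for n
  proof (cases "n < p")
    case True
    then have "\<zeta> ^ n \<noteq> 1" using root that by (auto simp: primitive_root_of_unity_def)
    then show ?thesis using eq[of n] by simp
  next
    case False
    then show ?thesis using f(3) by (intro Polynomial.coeff_eq_0) simp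
  qed
  then have "f = [:Polynomial.coeff f 0:]"
    by (intro poly_eqI) (simp add: coeff_pCons split: nat.split)
  then have "x = Polynomial.coeff f 0" using f(2) by (metis poly_pCons mult_zero_right poly_0 add.right_neutral)
  then show ?thesis using poly_over_coeff[OF f(1)] by simp
qed

text \<open>The coefficients are ring expressions in the roots. Their membership in \<open>L\<close>
  is part of the induction, since conjugation is additive and multiplicative only there.\<close>

lemma galois_conj_coeff_prod:
  assumes "finite A" "A \<subseteq> L"
  shows "L.poly_over (\<Prod>a\<in>A. [:- a, 1:])"
    and "galois_conj j (Polynomial.coeff (\<Prod>a\<in>A. [:- a, 1:]) n) = Polynomial.coeff (\<Prod>a\<in>A. [:- galois_conj j a, 1:]) n"
proof -
  have *: "L.poly_over (\<Prod>a\<in>A. [:- a, 1:]) \<and> (\<forall>n. galois_conj j (Polynomial.coeff (\<Prod>a\<in>A. [:- a, 1:]) n)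
      = Polynomial.coeff (\<Prod>a\<in>A. [:- galois_conj j a, 1:]) n)"
    using assms
  proof (induction A rule: finite_induct)
    case empty
    then show ?case by (auto simp: galois_conj_fixes)
  next
    case (insert a A)
    let ?f = "\<Prod>a\<in>A. [:- a, 1:]" and ?g = "\<Prod>a\<in>A. [:- galois_conj j a, 1:]"
    have IH: "L.poly_over ?f" "\<And>n. galois_conj j (Polynomial.coeff ?f n) = Polynomial.coeff ?g n"
      and a: "a \<in> L" using insert by auto
    have "galois_conj j (Polynomial.coeff ([:- a, 1:] * ?f) n)
        = Polynomial.coeff ([:- galois_conj j a, 1:] * ?g) n" for n
      using IH a L.poly_over_coeff[OF IH(1)]
      by (cases n) (simp_all add: coeff_pCons galois_conj_add galois_conj_diff galois_conj_mult galois_conj_uminus L.mult_mem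
        L.uminus_mem)
    moreover have "L.poly_over ([:- a, 1:] * ?f)"
      using IH(1) a by (intro L.poly_over_mult) auto
    ultimately show ?case using insert(1,2) by simp
  qed
  show "L.poly_over (\<Prod>a\<in>A. [:- a, 1:])"
    and "galois_conj j (Polynomial.coeff (\<Prod>a\<in>A. [:- a, 1:]) n) = Polynomial.coeff (\<Prod>a\<in>A. [:- galois_conj j a, 1:]) n"
    using * by auto
qed

text \<open>The minimal polynomial of x is the product over the set \<open>A\<close> of its
  conjugates. Conjugation permutes \<open>A\<close>, so the coefficients are fixed and lie in
  \<open>K\<close>. A nonzero polynomial over \<open>K\<close> that annihilates x annihilates all of
  \<open>A\<close>, so its degree is no smaller. Coinciding conjugates count once in a set, which
  keeps the roots simple.\<close>

lemma galois_extension: "galois_extension K L"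
proof -
  have "\<exists>f. is_min_poly K x f \<and> (\<exists>A. finite A \<and> A \<subseteq> L \<and> f = (\<Prod>a\<in>A. [:-a, 1:]))" if x: "x \<in> L" for x
  proof -
    define A where "A = (\<lambda>j. galois_conj j x) ` {..<p}"
    define f where "f = (\<Prod>a\<in>A. [:-a, 1:])"
    have A: "finite A" "A \<subseteq> L" using x by (auto simp: A_def galois_conj_mem)
    have "x \<in> A" using p_gt_0 galois_conj_0[OF x] by (force simp: A_def)
    have inj: "inj_on (galois_conj 1) A"
      using galois_conj_inverse(1)[of _ 1] p_gt_0 A(2) by (intro inj_on_inverseI[of _ "galois_conj (p - 1)"]) auto
    have "galois_conj 1 ` A \<subseteq> A"
    proof
      fix y assume "y \<in> galois_conj 1 ` A"
      then obtain j where "y = galois_conj 1 (galois_conj j x)" by (auto simp: A_def)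
      then have "y = galois_conj ((1 + j) mod p) x"
        using galois_conj_galois_conj[OF x] galois_conj_mod by simp
      then show "y \<in> A" using p_gt_0 by (auto simp: A_def)
    qed
    then have img: "galois_conj 1 ` A = A"
      using A(1) inj by (simp add: endo_inj_surj)
    have "f = (\<Prod>a\<in>A. [:- galois_conj 1 a, 1:])"
      unfolding f_def using prod.reindex[OF inj, of "\<lambda>a. [:- a, 1:]"] img by simp
    then have coeff: "Polynomial.coeff f n \<in> K" for n
      using galois_conj_1_fixed[OF L.poly_over_coeff[OF galois_conj_coeff_prod(1)[OF A]], of n]
        galois_conj_coeff_prod(2)[OF A, of 1 n] by (simp add: f_def)
    have deg: "Polynomial.degree f = card A"
      unfolding f_def by (subst Polynomial.degree_prod_eq_sum_degree) auto
    have monic: "Polynomial.lead_coeff f = 1"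
      unfolding f_def lead_coeff_prod by simp
    have rootA: "poly f x = 0"
      using \<open>x \<in> A\<close> A(1) unfolding f_def poly_prod by (intro prod_zero) auto
    have "Polynomial.degree f \<le> Polynomial.degree g"
      if g: "g \<noteq> 0" "\<forall>n. Polynomial.coeff g n \<in> K" "poly g x = 0" for g
    proof -
      have "poly g (galois_conj j x) = galois_conj j (poly g x)" for j
      proof -
        have "Polynomial.coeff g n \<in> L" for n using g(2) subset_adjoin by auto
        then show ?thesis
          using x g(2) by (simp add: poly_altdef galois_conj_sum L.mult_mem L.power_mem
            galois_conj_mult galois_conj_power galois_conj_fixes)
      qed
      then have "A \<subseteq> {y. poly g y = 0}"
        using g(3) galois_conj_fixes[OF zero_mem] by (auto simp: A_def)
      then have "card A \<le> card {y. poly g y = 0}"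
        by (rule card_mono[OF poly_roots_finite[OF g(1)]])
      then show ?thesis using card_poly_roots_bound[OF g(1)] deg by simp
    qed
    then have "is_min_poly K x f"
      using monic coeff rootA unfolding is_min_poly_def by simp
    then show ?thesis using A f_def by blast
  qed
  then show ?thesis
    unfolding galois_extension_def using subfield L_subfield subset_adjoin by simp
qed

text \<open>Elements of \<open>Bij L\<close> are extensional functions, hence the
  restriction.\<close>

definition galois_aut :: "nat \<Rightarrow> 'a \<Rightarrow> 'a" where
  "galois_aut j = restrict (galois_conj j) L"

lemma galois_aut_Bij: "galois_aut j \<in> Bij L"
proof -
  have "bij_betw (galois_conj (j mod p)) L L"
    using galois_conj_inverse p_gt_0
    by (intro bij_betw_byWitness[where f' = "galois_conj (p - j mod p)"]) (auto simp: galois_conj_mem)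
  then have "bij_betw (galois_aut j) L L"
    by (simp add: galois_aut_def galois_conj_mod cong: bij_betw_cong)
  then show ?thesis by (simp add: Bij_def galois_aut_def)
qed

lemma galois_group_iff:
  "\<sigma> \<in> carrier (galois_group K L) \<longleftrightarrow> \<sigma> \<in> Bij L \<and> (\<forall>x\<in>L. \<forall>y\<in>L. \<sigma> (x + y) = \<sigma> x + \<sigma> y) \<and>
     (\<forall>x\<in>L. \<forall>y\<in>L. \<sigma> (x * y) = \<sigma> x * \<sigma> y) \<and> (\<forall>x\<in>K. \<sigma> x = x)"
  unfolding galois_group_def using Bij_imp_funcset[of \<sigma> L]
  by (auto simp: Ring.ring_hom_def)

lemma galois_aut_mem: "galois_aut j \<in> carrier (galois_group K L)"
  unfolding galois_group_iff using galois_aut_Bij subset_adjoin[of \<beta>]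
  by (auto simp: galois_aut_def galois_conj_add galois_conj_mult galois_conj_fixes L.add_mem L.mult_mem)

text \<open>The quotient of \<sigma> \<beta> by \<beta> is a p-th root of unity because \<beta>^p is
  fixed, and the image of \<beta> determines \<sigma> on polynomial expressions in \<beta>.\<close>

lemma galois_group_cases:
  assumes "\<sigma> \<in> carrier (galois_group K L)"
  obtains j where "j < p" "\<sigma> = galois_aut j"
proof -
  have \<sigma>: "\<sigma> \<in> Bij L" "\<And>x y. x \<in> L \<Longrightarrow> y \<in> L \<Longrightarrow> \<sigma> (x + y) = \<sigma> x + \<sigma> y"
    "\<And>x y. x \<in> L \<Longrightarrow> y \<in> L \<Longrightarrow> \<sigma> (x * y) = \<sigma> x * \<sigma> y" "\<And>x. x \<in> K \<Longrightarrow> \<sigma> x = x"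
    using assms unfolding galois_group_iff by auto
  have pow: "\<sigma> (x ^ n) = \<sigma> x ^ n" if "x \<in> L" for x n
    using that by (induction n) (simp_all add: \<sigma>(3,4) L.power_mem)
  have sum: "\<sigma> (\<Sum>i\<in>A. f i) = (\<Sum>i\<in>A. \<sigma> (f i))" if "\<And>i. i \<in> A \<Longrightarrow> f i \<in> L" for A :: "nat set" and f
    using that by (induction A rule: infinite_finite_induct) (simp_all add: \<sigma>(2,4) L.sum_mem)
  have "\<sigma> \<beta> ^ p = \<beta> ^ p"
    using pow[OF mem_adjoin, of p] \<sigma>(4)[OF beta_power_mem] by simp
  then have "(\<sigma> \<beta> / \<beta>) ^ p = 1"
    unfolding power_divide using beta_nonzero by simp
  then obtain j where j: "j < p" "\<sigma> \<beta> / \<beta> = \<zeta> ^ j" by (rule root_of_unity_is_power)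
  then have \<beta>: "\<sigma> \<beta> = \<zeta> ^ j * \<beta>" using beta_nonzero by (simp add: field_simps)
  have "\<sigma> x = galois_conj j x" if x: "x \<in> L" for x
  proof -
    obtain f where f: "poly_over f" "x = poly f \<beta>" using x by (rule adjoinE)
    have c: "Polynomial.coeff f n \<in> L" "Polynomial.coeff f n \<in> K" for n
      using poly_over_coeff[OF f(1)] subset_adjoin by auto
    have "\<sigma> x = poly f (\<sigma> \<beta>)"
      using c mem_adjoin by (simp add: f(2) poly_altdef sum L.mult_mem L.power_mem \<sigma>(3,4) pow)
    then show ?thesis by (simp add: f(2) \<beta> galois_conj_poly[OF f(1)])
  qed
  then have "\<sigma> = galois_aut j"
    using Bij_imp_extensional[OF \<sigma>(1)] unfolding galois_aut_def
    by (intro extensionalityI[of _ L]) auto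
  then show ?thesis using that j(1) by blast
qed

lemma carrier_galois_group: "carrier (galois_group K L) = galois_aut ` {..<p}"
  using galois_group_cases galois_aut_mem by blast

lemma galois_aut_mod: "galois_aut (j mod p) = galois_aut j"
  by (simp add: galois_aut_def galois_conj_mod fun_eq_iff)

lemma galois_aut_mult: "galois_aut i \<otimes>\<^bsub>galois_group K L\<^esub> galois_aut j = galois_aut (i + j)"
  using galois_aut_Bij
  by (auto simp: galois_group_def BijGroup_def galois_aut_def compose_def galois_conj_mem
    galois_conj_galois_conj fun_eq_iff)

lemma galois_group_one: "\<one>\<^bsub>galois_group K L\<^esub> = galois_aut 0"
  by (auto simp: galois_group_def BijGroup_def galois_aut_def galois_conj_0 fun_eq_iff)

lemma group_galois_group: "group (galois_group K L)"
proof (rule groupI)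
  fix x y z assume "x \<in> carrier (galois_group K L)" "y \<in> carrier (galois_group K L)" "z \<in> carrier (galois_group K L)"
  then obtain i j k where "x = galois_aut i" "y = galois_aut j" "z = galois_aut k"
    by (metis galois_group_cases)
  then show "x \<otimes>\<^bsub>galois_group K L\<^esub> y \<otimes>\<^bsub>galois_group K L\<^esub> z = x \<otimes>\<^bsub>galois_group K L\<^esub> (y \<otimes>\<^bsub>galois_group K L\<^esub> z)"
    by (simp add: galois_aut_mult add.assoc)
next
  fix x y assume "x \<in> carrier (galois_group K L)" "y \<in> carrier (galois_group K L)"
  then obtain i j where "x = galois_aut i" "y = galois_aut j"
    by (metis galois_group_cases)
  then show "x \<otimes>\<^bsub>galois_group K L\<^esub> y \<in> carrier (galois_group K L)"
    by (simp add: galois_aut_mult galois_aut_mem)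
  show "\<one>\<^bsub>galois_group K L\<^esub> \<otimes>\<^bsub>galois_group K L\<^esub> y = y"
    by (simp add: galois_group_one galois_aut_mult \<open>y = galois_aut j\<close>)
next
  fix x assume "x \<in> carrier (galois_group K L)"
  then obtain j where j: "j < p" "x = galois_aut j" by (rule galois_group_cases)
  then have "galois_aut (p - j) \<otimes>\<^bsub>galois_group K L\<^esub> x = \<one>\<^bsub>galois_group K L\<^esub>"
    using galois_aut_mod[of p] by (simp add: galois_aut_mult galois_group_one)
  then show "\<exists>y\<in>carrier (galois_group K L). y \<otimes>\<^bsub>galois_group K L\<^esub> x = \<one>\<^bsub>galois_group K L\<^esub>"
    using galois_aut_mem by blast
qed (simp add: galois_group_one galois_aut_mem)

lemma cyclic_galois_group: "cyclic_group (galois_group K L)"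
proof -
  interpret G: group "galois_group K L" by (rule group_galois_group)
  have pow: "galois_aut 1 [^]\<^bsub>galois_group K L\<^esub> n = galois_aut n" for n :: nat
    by (induction n) (simp_all add: galois_group_one galois_aut_mult)
  have "carrier (galois_group K L) = range (\<lambda>n::int. galois_aut 1 [^]\<^bsub>galois_group K L\<^esub> n)"
  proof
    show "carrier (galois_group K L) \<subseteq> range (\<lambda>n::int. galois_aut 1 [^]\<^bsub>galois_group K L\<^esub> n)"
    proof
      fix x assume "x \<in> carrier (galois_group K L)"
      then obtain j where "x = galois_aut j" by (rule galois_group_cases)
      then have "x = galois_aut 1 [^]\<^bsub>galois_group K L\<^esub> int j"
        by (simp only: int_pow_int pow)
      then show "x \<in> range (\<lambda>n::int. galois_aut 1 [^]\<^bsub>galois_group K L\<^esub> n)" by (rule range_eqI)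
    qed
  qed (use galois_aut_mem in auto)
  then show ?thesis using G.cyclic_group galois_aut_mem by blast
qed

lemma order_galois_group: "Coset.order (galois_group K L) = p"
proof -
  have "inj_on galois_aut {..<p}"
  proof (rule inj_onI)
    fix i j assume ij: "i \<in> {..<p}" "j \<in> {..<p}" "galois_aut i = galois_aut j"
    then have "galois_conj i \<beta> = galois_conj j \<beta>"
      using mem_adjoin[of \<beta>] unfolding galois_aut_def by (metis restrict_apply')
    then have "\<zeta> ^ i = \<zeta> ^ j" using beta_nonzero by (simp add: galois_conj_beta)
    then show "i = j" using inj_zeta_power ij(1,2) by (auto dest: inj_onD)
  qed
  then show ?thesis by (simp add: Coset.order_def carrier_galois_group card_image)
qed

end

section \<open>Valuations in the tower\<close>

text \<open>The binomial terms for 1 < k < p are multiples of p x^2. The term k = 1 is grouped with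
  them, so that p x can be taken out as a factor.\<close>

lemma one_plus_power_prime:
  fixes x :: "'p::prime_card padic alg_closure"
  assumes "padic.integral x"
  obtains s where "padic.integral s"
    "(1 + x) ^ CARD('p) = 1 + x ^ CARD('p) + of_nat CARD('p) * x * (1 + x * s)"
proof -
  let ?p = "CARD('p)"
  have p: "Factorial_Ring.prime ?p" by (rule prime_card)
  then have p2: "?p \<ge> 2" by (rule prime_ge_2_nat)
  define s where "s = (\<Sum>k\<in>{2..<?p}. of_nat ((?p choose k) div ?p) * x ^ (k - 2))"
  have s: "padic.integral s" using assms by (auto simp: s_def)
  have split: "{..?p} = insert 0 (insert 1 (insert ?p {2..<?p}))" using p2 by auto
  have "(1 + x) ^ ?p = (\<Sum>k\<le>?p. of_nat (?p choose k) * x ^ k)"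
    using binomial_ring[of x 1 ?p] by (simp add: add.commute)
  also have "\<dots> = 1 + (of_nat ?p * x + (x ^ ?p + (\<Sum>k\<in>{2..<?p}. of_nat (?p choose k) * x ^ k)))"
    unfolding split using p2 by simp
  also have "(\<Sum>k\<in>{2..<?p}. of_nat (?p choose k) * x ^ k) = of_nat ?p * x * (x * s)"
    unfolding s_def sum_distrib_left
  proof (rule sum.cong)
    fix k assume k: "k \<in> {2..<?p}"
    then have "?p dvd (?p choose k)" using p by (intro dvd_choose_prime) auto
    then have "(of_nat (?p choose k) :: 'p padic alg_closure) = of_nat ?p * of_nat ((?p choose k) div ?p)"
      by (metis dvd_mult_div_cancel of_nat_mult)
    moreover have "x ^ k = x * (x * x ^ (k - 2))"
      using k by (simp add: power_eq_if numeral_2_eq_2)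
    ultimately show "of_nat (?p choose k) * x ^ k
        = of_nat ?p * x * (x * (of_nat ((?p choose k) div ?p) * x ^ (k - 2)))"
      by (simp add: mult_ac)
  qed simp
  finally have "(1 + x) ^ ?p = 1 + x ^ ?p + of_nat ?p * x * (1 + x * s)"
    by (simp add: algebra_simps)
  then show ?thesis using that s by blast
qed

text \<open>For x = z - 1 the expansion of (1 + x)^p = 1, divided by x, becomes x^(p - 1) = - p (1 +
  x s), and the factor 1 + x s is a unit.\<close>

lemma has_val_root_of_unity:
  fixes z :: "'p::prime_card padic alg_closure"
  assumes "z ^ CARD('p) = 1" "z \<noteq> 1"
  shows "has_val (z - 1) (1 / (of_nat CARD('p) - 1))"
proof -
  let ?p = "CARD('p)" and ?P = "of_nat CARD('p) :: 'p padic alg_closure"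
  have p2: "?p \<ge> 2" using prime_card[where 'a='p] by (rule prime_ge_2_nat)
  define x where "x = z - 1"
  have "padic.integral z" by (rule padic.integral_root[of _ ?p]) (use assms(1) p2 in auto)
  then have x: "padic.integral x" by (auto simp: x_def)
  obtain s where s: "padic.integral s" "(1 + x) ^ ?p = 1 + x ^ ?p + ?P * x * (1 + x * s)"
    using one_plus_power_prime[OF x] .
  have "x ^ ?p = - (?P * x * (1 + x * s))"
    using s(2) assms(1) by (simp add: x_def eq_neg_iff_add_eq_0)
  moreover have "x ^ ?p = x * x ^ (?p - 1)" using p2 by (simp flip: power_Suc)
  ultimately have "x * x ^ (?p - 1) = x * (?P * (- (1 + x * s)))" by (simp add: algebra_simps)
  then have eq: "x ^ (?p - 1) = ?P * (- (1 + x * s))"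
    using assms(2) by (simp add: x_def)
  have "int_unit (1 - (- (x * s)))"
  proof (rule int_unit_one_minus_if_power)
    show "has_val ?P 1" by simp
    have "(- (x * s)) ^ (?p - 1) = x ^ (?p - 1) * (- s) ^ (?p - 1)"
      by (metis mult_minus_right power_mult_distrib)
    then show "(- (x * s)) ^ (?p - 1) = ?P * ((- (1 + x * s)) * (- s) ^ (?p - 1))"
      by (simp only: eq mult.assoc)
    show "?p - 1 > 0" using p2 by simp
    show "padic.integral ((- (1 + x * s)) * (- s) ^ (?p - 1))" using x s(1) by blast
  qed simp
  then have "int_unit (- (1 + x * s))" by (intro int_unit_uminus) simp
  then have "has_val (x ^ (?p - 1)) 1" unfolding eq by (intro has_val_mult_unit) simp_all
  then have "has_val x (1 / of_nat (?p - 1))" by (rule has_val_root) (use p2 in simp)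
  then show ?thesis using p2 by (simp add: x_def of_nat_diff)
qed

text \<open>The difference is e times a geometric sum, and that sum is m modulo e, a unit because p
  does not divide m.\<close>

lemma has_val_one_plus_power_diff:
  fixes e :: "'p::prime_card padic alg_closure"
  assumes "has_val e q" "q > 0" "\<not> CARD('p) dvd m"
  shows "has_val ((1 + e) ^ m - 1) q"
proof -
  let ?m = "of_nat m :: 'p padic alg_closure"
  have e: "padic.integral e" using has_val_integral_iff[OF assms(1)] assms(2) by simp
  have pow: "(1 + e) ^ n - 1 = e * (\<Sum>i<n. (1 + e) ^ i)" for n
    using power_diff_1_eq[of "1 + e" n] by simp
  define w where "w = (\<Sum>i<m. \<Sum>k<i. (1 + e) ^ k)"
  have w: "padic.integral w"
    unfolding w_def using e by (intro integral_sum integral_power integral_add integral_1)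
  have "(\<Sum>i<m. (1 + e) ^ i) = (\<Sum>i<m. 1 + e * (\<Sum>k<i. (1 + e) ^ k))"
    by (rule sum.cong) (simp_all add: pow[symmetric])
  also have "\<dots> = ?m + e * w"
    by (simp add: sum.distrib w_def sum_distrib_left)
  finally have sum: "(\<Sum>i<m. (1 + e) ^ i) = ?m + e * w" .
  have m: "int_unit ?m" by (rule int_unit_of_nat[OF assms(3)])
  then have nz: "?m \<noteq> 0" by (simp add: int_unit_def)
  have "int_unit (1 - (- (e * w / ?m)))"
  proof (rule int_unit_one_minus_if_power[OF assms(1,2), of _ 1])
    show "(- (e * w / ?m)) ^ 1 = e * (- (w * inverse ?m))" by (simp add: divide_inverse)
    show "padic.integral (- (w * inverse ?m))" using w m by (auto simp: int_unit_def)
  qed simp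
  then have "int_unit (?m * (1 - (- (e * w / ?m))))" using m by auto
  then have "int_unit (?m + e * w)" using nz by (simp add: algebra_simps)
  then show ?thesis unfolding pow sum using assms(1) by (intro has_val_mult_unit)
qed

text \<open>The second assumption bounds the value group and also says that the partial valuation
  \<open>has_val\<close> is defined at every nonzero element of \<open>K\<close>.\<close>

locale padic_subfield = type_subfield K
  for K :: "'p::prime_card padic alg_closure set" +
  fixes N :: nat
  assumes N_pos: "N > 0"
    and val_denominator: "\<And>x. x \<in> K \<Longrightarrow> x \<noteq> 0 \<Longrightarrow> \<exists>n. has_val x (of_int n / of_nat N)"
begin

text \<open>If two terms of f(y), of degrees i < j, had the same value, then (j - i) q N would be an
  integer. So the values are distinct and the least term, of degree k, gives the value of f(y). The
  last clause records that no term has a smaller value than the sum.\<close>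

lemma poly_val:
  assumes y: "has_val y q" and q: "\<And>k. 0 < k \<Longrightarrow> k < d \<Longrightarrow> of_nat k * q * of_nat N \<notin> \<int>"
    and f: "poly_over f" "f \<noteq> 0" "Polynomial.degree f < d"
  obtains k n where "k < d" "has_val (poly f y) (of_int n / of_nat N + of_nat k * q)"
    "\<forall>j. Polynomial.coeff f j \<noteq> 0 \<longrightarrow>
       (\<exists>l. has_val (Polynomial.coeff f j * y ^ j) (of_int l / of_nat N + of_nat j * q) \<and>
         of_int n / of_nat N + of_nat k * q \<le> of_int l / of_nat N + of_nat j * q)"
proof -
  define A where "A = {j. Polynomial.coeff f j \<noteq> 0}"
  have Ad: "j \<le> Polynomial.degree f" "j < d" if "j \<in> A" for j
    using that f(3) le_degree[of f j] by (auto simp: A_def)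
  have fin: "finite A" by (rule finite_subset[of _ "{..<d}"]) (use Ad in auto)
  have "Polynomial.degree f \<in> A" using f(2) by (simp add: A_def)
  then have ne: "A \<noteq> {}" by auto
  have "\<forall>j\<in>A. \<exists>n. has_val (Polynomial.coeff f j) (of_int n / of_nat N)"
    using val_denominator poly_over_coeff[OF f(1)] by (simp add: A_def)
  then obtain n where n: "\<And>j. j \<in> A \<Longrightarrow> has_val (Polynomial.coeff f j) (of_int (n j) / of_nat N)"
    by metis
  define v where "v j = of_int (n j) / of_nat N + of_nat j * q" for j
  have term_val: "has_val (Polynomial.coeff f j * y ^ j) (v j)" if "j \<in> A" for j
    unfolding v_def using n[OF that] has_val_power[OF y] by (rule has_val_mult)
  have "inj_on v A"
  proof (rule linorder_inj_onI)
    fix i j assume ij: "i < j" "i \<in> A" "j \<in> A"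
    show "v i \<noteq> v j"
    proof
      assume "v i = v j"
      then have "of_int (n i) + of_nat i * q * of_nat N = of_int (n j) + of_nat j * q * of_nat N"
        using N_pos by (simp add: v_def field_simps)
      then have "of_nat (j - i) * q * of_nat N = of_int (n i - n j)"
        using ij(1) by (simp add: of_nat_diff algebra_simps)
      then have "of_nat (j - i) * q * of_nat N \<in> \<int>" by (simp only: Ints_of_int)
      moreover have "of_nat (j - i) * q * of_nat N \<notin> \<int>"
        using ij(1) Ad(2)[OF ij(3)] by (intro q) simp_all
      ultimately show False by contradiction
    qed
  qed auto
  from has_val_sum_distinct[OF fin ne term_val this]
  obtain k where k: "k \<in> A" "has_val (\<Sum>j\<in>A. Polynomial.coeff f j * y ^ j) (v k)" "\<forall>j\<in>A. v k \<le> v j"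
    by blast
  have "poly f y = (\<Sum>j\<in>A. Polynomial.coeff f j * y ^ j)"
    unfolding poly_altdef
    by (rule sum.mono_neutral_right) (use Ad in \<open>auto simp: A_def\<close>)
  then have "has_val (poly f y) (v k)" using k(2) by simp
  note * = Ad(2)[OF k(1)] this[unfolded v_def]
  show ?thesis
  proof (rule that[OF *], intro allI impI)
    fix j assume "Polynomial.coeff f j \<noteq> 0"
    then have "j \<in> A" by (simp add: A_def)
    then have "has_val (Polynomial.coeff f j * y ^ j) (v j) \<and> v k \<le> v j"
      using term_val k(3) by simp
    then show "\<exists>l. has_val (Polynomial.coeff f j * y ^ j) (of_int l / of_nat N + of_nat j * q) \<and>
         of_int (n k) / of_nat N + of_nat k * q \<le> of_int l / of_nat N + of_nat j * q"
      unfolding v_def by (rule exI[of _ "n j"])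
  qed
qed

lemma poly_nonzero:
  assumes "has_val y q" "\<And>k. 0 < k \<Longrightarrow> k < d \<Longrightarrow> of_nat k * q * of_nat N \<notin> \<int>"
    "poly_over f" "f \<noteq> 0" "Polynomial.degree f < d"
  shows "poly f y \<noteq> 0"
  using poly_val[OF assms] has_val_nonzero by metis

lemma poly_val_denominator:
  assumes "has_val y (of_int c / of_nat (e * N))" "e > 0"
    "\<And>k. 0 < k \<Longrightarrow> k < d \<Longrightarrow> of_nat k * (of_int c / of_nat (e * N)) * of_nat N \<notin> (\<int> :: rat set)"
    "poly_over f" "f \<noteq> 0" "Polynomial.degree f < d"
  shows "\<exists>n. has_val (poly f y) (of_int n / of_nat (e * N))"
proof -
  obtain k n where "has_val (poly f y) (of_int n / of_nat N + of_nat k * (of_int c / of_nat (e * N)))"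
    using poly_val[OF assms(1,3-6)] by metis
  moreover have "of_int n / of_nat N + of_nat k * (of_int c / of_nat (e * N))
      = (of_int (n * int e + int k * c) / of_nat (e * N) :: rat)"
    using assms(2) N_pos by (simp add: field_simps)
  ultimately show ?thesis by metis
qed

end

lemma divide_nat_not_Ints:
  assumes "\<not> (n::nat) dvd k" "n > 0"
  shows "of_nat k / of_nat n \<notin> (\<int> :: rat set)"
proof
  assume "of_nat k / of_nat n \<in> (\<int> :: rat set)"
  then obtain m where "of_nat k / of_nat n = (of_int m :: rat)" by (elim Ints_cases)
  then have "(of_int (int k) :: rat) = of_int (m * int n)" using assms(2) by (simp add: field_simps)
  then have "int k = m * int n" by (simp only: of_int_eq_iff)
  then have "int n dvd int k" by simp
  then show False using assms(1) by simp
qed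

section \<open>The tower of Kummer extensions\<close>

locale kummer_tower =
  fixes b :: "'p::prime_card padic"
    and \<zeta> :: "'p padic alg_closure"
    and \<beta> :: "nat \<Rightarrow> 'p padic alg_closure"
  assumes val_b: "padic_val (b ^ (CARD('p) - 1) - 1) = 1"
    and zeta: "primitive_root_of_unity CARD('p) \<zeta>"
    and beta_0: "\<beta> 0 = to_ac b"
    and beta_Suc: "\<And>i. \<beta> (Suc i) ^ CARD('p) = \<beta> i"
begin

lemma prime_p: "Factorial_Ring.prime CARD('p)"
  by (rule prime_card)

lemma p_ge_2: "CARD('p) \<ge> 2"
  using prime_p by (rule prime_ge_2_nat)

abbreviation B :: "'p padic alg_closure" where "B \<equiv> to_ac b"

lemma B_power:
  obtains u where "int_unit u" "B ^ (CARD('p) - 1) = 1 + of_nat CARD('p) * u"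
proof -
  \<comment> \<open>The dummy value of \<open>padic_val\<close> at 0 is 0 and not 1.\<close>
  have nz: "b ^ (CARD('p) - 1) - 1 \<noteq> 0" using val_b by (auto simp: padic_val_def)
  obtain k and u :: "'p padic_int" where u: "u dvd 1"
      and eq: "b ^ (CARD('p) - 1) - 1 = of_nat CARD('p) powi k * Fract u 1"
    using padic_decompose[OF nz] .
  have "k = 1" using padic_val_eqI[OF u eq] val_b by simp
  then have "b ^ (CARD('p) - 1) - 1 = of_nat CARD('p) * Fract u 1" using eq by simp
  then have "to_ac (b ^ (CARD('p) - 1) - 1) = of_nat CARD('p) * of_padic_int u"
    by (simp add: of_padic_int_def)
  then have "B ^ (CARD('p) - 1) = 1 + of_nat CARD('p) * of_padic_int u"
    by (simp add: algebra_simps)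
  then show ?thesis by (rule that[OF int_unit_of_padic_int[OF u]])
qed

lemma B_unit: "int_unit B"
proof -
  obtain u where u: "int_unit u" "B ^ (CARD('p) - 1) = 1 + of_nat CARD('p) * u" by (rule B_power)
  have "int_unit (1 - of_nat CARD('p) * (- u))"
    by (rule int_unit_one_minus_prime_mult) (use u(1) in \<open>auto simp: int_unit_def\<close>)
  then have "int_unit (B ^ (CARD('p) - 1))" unfolding u(2) by simp
  then show ?thesis by (rule int_unit_root) (use p_ge_2 in simp)
qed

lemma B_nonzero: "B \<noteq> 0"
  using B_unit by (simp add: int_unit_def)

lemma beta_unit: "int_unit (\<beta> i)"
proof (induction i)
  case 0
  then show ?case by (simp add: beta_0 B_unit)
next
  case (Suc i)
  then have "int_unit (\<beta> (Suc i) ^ CARD('p))" by (simp add: beta_Suc)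
  then show ?case by (rule int_unit_root) (use p_ge_2 in simp)
qed

definition y :: "nat \<Rightarrow> 'p padic alg_closure" where
  "y i = \<beta> i / B - 1"

lemma beta_eq: "\<beta> i = B * (1 + y i)"
  using B_nonzero by (simp add: y_def)

lemma y_integral: "padic.integral (y i)"
proof -
  have "int_unit (\<beta> i / B)" by (rule int_unit_divide[OF beta_unit B_unit])
  then show ?thesis by (auto simp: y_def int_unit_def)
qed

text \<open>\<open>(1 + y (i + 1)) ^ p\<close> and \<open>1 + y i\<close> differ by the factor \<open>b ^ (1 - p)\<close>, which is 1 plus
  \<open>p\<close> times a unit. So \<open>y (i + 1) ^ p\<close> has the valuation of \<open>p\<close> for \<open>i = 0\<close>, and of \<open>y i\<close>
  otherwise.\<close>

lemma val_y: "has_val (y (Suc i)) (1 / of_nat (CARD('p) ^ Suc i))"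
proof -
  let ?P = "of_nat CARD('p) :: 'p padic alg_closure"
  obtain u where u: "int_unit u" "B ^ (CARD('p) - 1) = 1 + ?P * u" by (rule B_power)
  define c where "c = inverse (B ^ (CARD('p) - 1))"
  have c: "int_unit c" using B_unit by (auto simp: c_def)
  have "c * (1 + ?P * u) = 1" using B_nonzero by (simp add: c_def flip: u(2))
  then have c_eq: "c = 1 + ?P * (- (c * u))" by (simp add: algebra_simps)
  have rel: "(1 + y (Suc j)) ^ CARD('p) = (1 + y j) * c" for j
  proof -
    have "B ^ CARD('p) = B * B ^ (CARD('p) - 1)" using p_ge_2 by (simp flip: power_Suc)
    then have "(\<beta> (Suc j) / B) ^ CARD('p) = \<beta> j / B * c"
      using B_nonzero by (simp add: power_divide beta_Suc c_def field_simps)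
    then show ?thesis by (simp add: y_def)
  qed
  \<comment> \<open>By \<open>c_eq\<close> the element in \<open>R\<close> is (1 + y j) c - 1, and
    by \<open>rel\<close> this is (1 + y (j + 1))^p - 1.\<close>
  have step: "has_val (y (Suc j)) (1 / of_nat (CARD('p) ^ Suc j))"
    if R: "has_val (y j * c + ?P * (- (c * u))) (1 / of_nat (CARD('p) ^ j))" for j
  proof -
    define r where "r = y j * c + ?P * (- (c * u))"
    have "has_val r (1 / of_nat (CARD('p) ^ j))" using R by (simp add: r_def)
    note r = this has_val_nonzero[OF this]
    have le: "(1 / of_nat (CARD('p) ^ j) :: rat) \<le> 1" using p_ge_2 by simp
    have pr: "padic.integral (?P / r)" by (rule integral_if_val_le[OF r(1) has_val_prime le])
    obtain s where s: "padic.integral s"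
        "(1 + y (Suc j)) ^ CARD('p) = 1 + y (Suc j) ^ CARD('p) + ?P * y (Suc j) * (1 + y (Suc j) * s)"
      using one_plus_power_prime[OF y_integral] .
    \<comment> \<open>As r has at most the value of p, the quotient p / r is integral and the mixed
      binomial terms can be written as r z. Then y (j + 1)^p = r (1 - z), and z^p is a multiple of y
      (j + 1)^p and so of r. Hence 1 - z is a unit although the value of y (j + 1) is still
      unknown.\<close>
    define w where "w = ?P / r * (1 + y (Suc j) * s)"
    define z where "z = y (Suc j) * w"
    have w: "padic.integral w"
      unfolding w_def by (intro integral_mult[OF pr] integral_add integral_1 integral_mult s(1) y_integral)
    have z: "padic.integral z" using w y_integral by (auto simp: z_def)
    have "(1 + y j) * c = 1 + r" using c_eq by (simp add: r_def algebra_simps)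
    then have "y (Suc j) ^ CARD('p) + ?P * y (Suc j) * (1 + y (Suc j) * s) = r"
      using s(2) rel[of j] by (simp add: add.assoc)
    moreover have "?P * y (Suc j) * (1 + y (Suc j) * s) = r * z"
      using r(2) by (simp add: z_def w_def)
    ultimately have "y (Suc j) ^ CARD('p) = r - r * z" by (simp add: eq_diff_eq)
    then have yp: "y (Suc j) ^ CARD('p) = r * (1 - z)" by (simp add: algebra_simps)
    have "int_unit (1 - z)"
    proof (rule int_unit_one_minus_if_power[OF r(1)])
      show "(1 / of_nat (CARD('p) ^ j) :: rat) > 0" using p_ge_2 by simp
      show "z ^ CARD('p) = r * ((1 - z) * w ^ CARD('p))" by (simp add: z_def power_mult_distrib yp)
      show "CARD('p) > 0" using p_ge_2 by simp
      show "padic.integral ((1 - z) * w ^ CARD('p))" using z w by auto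
    qed
    then have "has_val (y (Suc j) ^ CARD('p)) (1 / of_nat (CARD('p) ^ j))"
      unfolding yp using r(1) by (intro has_val_mult_unit)
    then have "has_val (y (Suc j)) (1 / of_nat (CARD('p) ^ j) / of_nat CARD('p))"
      by (rule has_val_root) (use p_ge_2 in simp)
    then show ?thesis by (simp add: mult.commute)
  qed
  have Pcu: "has_val (?P * (- (c * u))) 1"
    using c u(1) by (intro has_val_mult_unit) auto
  show ?thesis
  proof (induction i)
    case 0
    have "y 0 = 0" using B_nonzero by (simp add: y_def beta_0)
    then show ?case using step[of 0] Pcu by simp
  next
    case (Suc i)
    have "has_val (y (Suc i) * c + ?P * (- (c * u))) (1 / of_nat (CARD('p) ^ Suc i))"
    proof (rule has_val_add_less[OF _ Pcu])
      show "has_val (y (Suc i) * c) (1 / of_nat (CARD('p) ^ Suc i))" using Suc c by (intro has_val_mult_unit)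
      have "1 < CARD('p) ^ Suc i" using p_ge_2 by (intro one_less_power) auto
      then have "(1 :: rat) < of_nat (CARD('p) ^ Suc i)" by (metis of_nat_1 of_nat_less_iff)
      then show "(1 / of_nat (CARD('p) ^ Suc i) :: rat) < 1" by simp
    qed
    then show ?case by (rule step)
  qed
qed

text \<open>One formula for all i: since \<open>\<beta> 0\<close> comes from b, the field
  \<open>K 0\<close> is generated by \<zeta> alone.\<close>

definition K :: "nat \<Rightarrow> 'p padic alg_closure set" where
  "K i = Qp_adjoin {\<zeta>, \<beta> i}"

definition lam :: "'p padic alg_closure" where
  "lam = \<zeta> - 1"

lemma val_lam: "has_val lam (1 / (of_nat CARD('p) - 1))"
proof -
  have "\<zeta> ^ CARD('p) = 1" "\<zeta> \<noteq> 1"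
    using zeta p_ge_2 by (auto simp: primitive_root_of_unity_def dest: spec[of _ 1])
  then show ?thesis unfolding lam_def by (rule has_val_root_of_unity)
qed

lemma type_subfield_K: "type_subfield (K i)"
  unfolding K_def by (rule type_subfield.intro) (rule Qp_adjoin_subfield)

lemma zeta_mem_K: "\<zeta> \<in> K i" and beta_mem_K: "\<beta> i \<in> K i" and to_ac_mem_K: "to_ac x \<in> K i"
  using Qp_adjoin_superset[of "{\<zeta>, \<beta> i}"] unfolding K_def by auto

lemma y_mem_K: "y i \<in> K i" and lam_mem_K: "lam \<in> K i"
proof -
  interpret type_subfield "K i" by (rule type_subfield_K)
  show "y i \<in> K i" unfolding y_def by (intro diff_mem divide_mem beta_mem_K to_ac_mem_K one_mem)
  show "lam \<in> K i" unfolding lam_def by (intro diff_mem zeta_mem_K one_mem)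
qed

definition e :: "nat \<Rightarrow> nat" where
  "e i = CARD('p) ^ i * (CARD('p) - 1)"

lemma e_pos: "e i > 0"
  using p_ge_2 by (simp add: e_def)

text \<open>The powers of \<open>lam\<close> below the exponent p - 1 have values that are distinct
  modulo the integers, so \<open>poly_val_denominator\<close> applies over the p-adic numbers
  themselves.\<close>

lemma padic_subfield_K_0: "padic_subfield (K 0) (e 0)"
proof -
  interpret Qp: padic_subfield "range to_ac :: 'p padic alg_closure set" 1
  proof (intro padic_subfield.intro type_subfield.intro padic_subfield_axioms.intro subfield_range_to_ac)
    fix x :: "'p padic alg_closure" assume "x \<in> range to_ac" "x \<noteq> 0"
    then obtain a where "x = to_ac a" "a \<noteq> 0" by auto
    then have "has_val x (of_int (padic_val a) / of_nat 1)" using has_val_to_ac[of a] by simp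
    then show "\<exists>n. has_val x (of_int n / of_nat 1)" by (rule exI)
  qed simp
  \<comment> \<open>This is ((1 + X)^p - 1) / X, a polynomial of degree p - 1 with the root
    \<open>lam\<close>. It reduces the degree of polynomial expressions in
    \<open>lam\<close>.\<close>
  define m :: "'p padic alg_closure poly" where
    "m = (\<Sum>k<CARD('p). Polynomial.monom (of_nat (CARD('p) choose Suc k)) k)"
  have coeff_m: "Polynomial.coeff m n = (if n < CARD('p) then of_nat (CARD('p) choose Suc n) else 0)" for n
    by (simp add: m_def coeff_sum coeff_monom)
  have m_over: "Qp.poly_over m"
    unfolding Qp.poly_over_def coeff_m by simp
  have deg: "Polynomial.degree m = CARD('p) - 1"
  proof (rule antisym)
    show "Polynomial.degree m \<le> CARD('p) - 1" by (rule degree_le) (auto simp: coeff_m)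
    show "CARD('p) - 1 \<le> Polynomial.degree m" by (rule le_degree) (use p_ge_2 in \<open>simp add: coeff_m\<close>)
  qed
  then have "m \<noteq> 0" using p_ge_2 by auto
  have "1 = (lam + 1) ^ CARD('p)" using zeta by (simp add: lam_def primitive_root_of_unity_def)
  also have "\<dots> = (\<Sum>k\<le>CARD('p). of_nat (CARD('p) choose k) * lam ^ k)"
    using binomial_ring[of lam 1 "CARD('p)"] by simp
  also have "\<dots> = 1 + (\<Sum>k<CARD('p). of_nat (CARD('p) choose Suc k) * lam ^ Suc k)"
    using sum.lessThan_Suc_shift[of "\<lambda>k. of_nat (CARD('p) choose k) * lam ^ k" "CARD('p)"]
    by (simp only: lessThan_Suc_atMost) simp
  also have "(\<Sum>k<CARD('p). of_nat (CARD('p) choose Suc k) * lam ^ Suc k) = lam * poly m lam"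
    by (simp add: m_def poly_sum poly_monom sum_distrib_left mult.left_commute)
  finally have "poly m lam = 0" using has_val_nonzero[OF val_lam] by simp
  note m = m_over this
  have sub: "subfield (Qp.adjoin lam) ring_of_type_algebra"
    by (rule Qp.adjoin_subfield[OF m \<open>m \<noteq> 0\<close>])
  interpret A: type_subfield "Qp.adjoin lam" by (rule type_subfield.intro[OF sub])
  have "lam + 1 \<in> Qp.adjoin lam" by (intro A.add_mem Qp.mem_adjoin A.one_mem)
  then have K0: "K 0 \<subseteq> Qp.adjoin lam"
    unfolding K_def using Qp.subset_adjoin sub by (intro Qp_adjoin_least) (auto simp: beta_0 lam_def)
  interpret K0: type_subfield "K 0" by (rule type_subfield_K)
  show ?thesis
  proof
    show "e 0 > 0" by (rule e_pos)
    fix x assume x: "x \<in> K 0" "x \<noteq> 0"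
    obtain f where f: "Qp.poly_over f" "x = poly f lam" "Polynomial.degree f < CARD('p) - 1"
      using Qp.adjoin_reduced[OF m, of x] K0 x(1) deg p_ge_2 by auto
    have "f \<noteq> 0" using f(2) x(2) by auto
    have "\<exists>n. has_val (poly f lam) (of_int n / of_nat ((CARD('p) - 1) * 1))"
    proof (rule Qp.poly_val_denominator[OF _ _ _ f(1) \<open>f \<noteq> 0\<close> f(3)])
      show "has_val lam (of_int 1 / of_nat ((CARD('p) - 1) * 1))"
        using val_lam p_ge_2 by (simp add: of_nat_diff)
      show "CARD('p) - 1 > 0" using p_ge_2 by simp
      fix k assume "0 < k" "k < CARD('p) - 1"
      then have "\<not> CARD('p) - 1 dvd k" by (auto dest: dvd_imp_le)
      then show "of_nat k * (of_int 1 / of_nat ((CARD('p) - 1) * 1)) * of_nat 1 \<notin> (\<int> :: rat set)"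
        using divide_nat_not_Ints[of "CARD('p) - 1" k] p_ge_2 by simp
    qed
    then show "\<exists>n. has_val x (of_int n / of_nat (e 0))" by (simp add: e_def f(2))
  qed
qed

text \<open>The product is k (p - 1) / p, and p divides neither factor of the numerator. This is the
  hypothesis of \<open>poly_val\<close> for y (i + 1) over \<open>K i\<close>.\<close>

lemma val_y_denominator:
  assumes "0 < k" "k < CARD('p)"
  shows "of_nat k * (1 / of_nat (CARD('p) ^ Suc i)) * of_nat (e i) \<notin> (\<int> :: rat set)"
proof -
  have "\<not> CARD('p) dvd k" using assms by (auto dest: dvd_imp_le)
  moreover have "\<not> CARD('p) dvd CARD('p) - 1" using p_ge_2 by (auto dest: dvd_imp_le)
  ultimately have "\<not> CARD('p) dvd k * (CARD('p) - 1)" using prime_p by (simp add: prime_dvd_mult_iff)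
  moreover have "of_nat k * (1 / of_nat (CARD('p) ^ Suc i)) * of_nat (e i)
      = (of_nat (k * (CARD('p) - 1)) / of_nat CARD('p) :: rat)"
    using p_ge_2 by (simp add: e_def)
  ultimately show ?thesis using divide_nat_not_Ints[of "CARD('p)" "k * (CARD('p) - 1)"] p_ge_2 by simp
qed

text \<open>Substituting \<beta> = b (1 + y) turns a relation of degree below p for
  \<open>\<beta> (Suc i)\<close> into one for \<open>y (Suc i)\<close>, which distinct values
  exclude. For the second claim, \<open>\<beta> i\<close> is a power of
  \<open>\<beta> (Suc i)\<close> and hence redundant as a generator.\<close>

lemma kummer_extension_K:
  assumes "padic_subfield (K i) (e i)"
  shows "kummer_extension (K i) \<zeta> (\<beta> (Suc i)) CARD('p)"
    and "K (Suc i) = type_subfield.adjoin (K i) (\<beta> (Suc i))"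
proof -
  interpret padic_subfield "K i" "e i" by fact
  show kummer: "kummer_extension (K i) \<zeta> (\<beta> (Suc i)) CARD('p)"
  proof
    show "CARD('p) > 1" using p_ge_2 by simp
    show "primitive_root_of_unity CARD('p) \<zeta>" by (rule zeta)
    show "\<zeta> \<in> K i" by (rule zeta_mem_K)
    show "\<beta> (Suc i) ^ CARD('p) \<in> K i" by (simp add: beta_Suc beta_mem_K)
    fix f assume f: "poly_over f" "Polynomial.degree f < CARD('p)" "poly f (\<beta> (Suc i)) = 0"
    show "f = 0"
    proof (rule ccontr)
      assume "f \<noteq> 0"
      let ?g = "f \<circ>\<^sub>p [:B, B:]"
      have over: "poly_over ?g" using f(1) to_ac_mem_K by (intro poly_over_pcompose) auto
      have nz: "?g \<noteq> 0" using \<open>f \<noteq> 0\<close> B_nonzero pcompose_eq_0[of f "[:B, B:]"] by auto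
      have "Polynomial.degree ?g < CARD('p)"
        using f(2) degree_pcompose_le[of f "[:B, B:]"] B_nonzero by simp
      then have "poly ?g (y (Suc i)) \<noteq> 0"
        using poly_nonzero[OF val_y val_y_denominator over nz] by blast
      then show False using f(3) by (simp add: poly_pcompose beta_eq algebra_simps)
    qed
  qed
  then interpret kummer_extension "K i" \<zeta> "\<beta> (Suc i)" "CARD('p)" .
  have "Qp_adjoin {\<beta> (Suc i), \<zeta>, \<beta> i} = adjoin (\<beta> (Suc i))"
    by (rule Qp_adjoin_insert[of "{\<zeta>, \<beta> i}", folded K_def,
        OF poly_over_kummer_poly poly_kummer_poly_beta kummer_poly_nonzero])
  moreover have "Qp_adjoin {\<beta> (Suc i), \<zeta>, \<beta> i} = K (Suc i)"
  proof
    interpret M: type_subfield "K (Suc i)" by (rule type_subfield_K)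
    have "\<beta> i \<in> K (Suc i)" using M.power_mem[OF beta_mem_K, of "CARD('p)"] by (simp add: beta_Suc)
    then show "Qp_adjoin {\<beta> (Suc i), \<zeta>, \<beta> i} \<subseteq> K (Suc i)"
      using zeta_mem_K beta_mem_K to_ac_mem_K M.subfield by (intro Qp_adjoin_least) auto
    show "K (Suc i) \<subseteq> Qp_adjoin {\<beta> (Suc i), \<zeta>, \<beta> i}"
      unfolding K_def using Qp_adjoin_superset[of "{\<beta> (Suc i), \<zeta>, \<beta> i}"]
      by (intro Qp_adjoin_least Qp_adjoin_subfield) auto
  qed
  ultimately show "K (Suc i) = adjoin (\<beta> (Suc i))" by simp
qed

lemma K_Suc_reduced:
  assumes "padic_subfield (K i) (e i)" "x \<in> K (Suc i)"
  obtains f where "type_subfield.poly_over (K i) f" "x = poly f (y (Suc i))" "Polynomial.degree f < CARD('p)"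
proof -
  interpret padic_subfield "K i" "e i" by fact
  interpret kummer_extension "K i" \<zeta> "\<beta> (Suc i)" "CARD('p)" by (rule kummer_extension_K) fact
  obtain f where f: "poly_over f" "x = poly f (\<beta> (Suc i))" "Polynomial.degree f < CARD('p)"
    using L_reduced[OF assms(2)[unfolded kummer_extension_K(2)[OF assms(1)]]] .
  let ?g = "f \<circ>\<^sub>p [:B, B:]"
  have "poly_over ?g" using f(1) to_ac_mem_K by (intro poly_over_pcompose) auto
  moreover have "x = poly ?g (y (Suc i))"
    by (simp add: f(2) poly_pcompose beta_eq algebra_simps)
  moreover have "Polynomial.degree ?g < CARD('p)"
    using f(3) degree_pcompose_le[of f "[:B, B:]"] B_nonzero by simp
  ultimately show ?thesis by (rule that)
qed

lemma padic_subfield_K: "padic_subfield (K i) (e i)"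
proof (induction i)
  case 0
  show ?case by (rule padic_subfield_K_0)
next
  case (Suc i)
  interpret padic_subfield "K i" "e i" by (rule Suc)
  interpret L: type_subfield "K (Suc i)" by (rule type_subfield_K)
  have e_Suc: "e (Suc i) = CARD('p) * e i" by (simp add: e_def)
  \<comment> \<open>The value of y (i + 1), rewritten with the new denominator p e i, has the
    numerator p - 1.\<close>
  have val_eq: "(of_int (int (CARD('p) - 1)) / of_nat (CARD('p) * e i) :: rat) = 1 / of_nat (CARD('p) ^ Suc i)"
    using p_ge_2 by (simp add: e_def field_simps)
  show ?case
  proof
    show "e (Suc i) > 0" by (rule e_pos)
    fix x assume x: "x \<in> K (Suc i)" "x \<noteq> 0"
    obtain f where f: "poly_over f" "x = poly f (y (Suc i))" "Polynomial.degree f < CARD('p)"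
      using K_Suc_reduced[OF Suc x(1)] .
    have "f \<noteq> 0" using f(2) x(2) by auto
    have "\<exists>n. has_val (poly f (y (Suc i))) (of_int n / of_nat (CARD('p) * e i))"
      by (rule poly_val_denominator[of _ "int (CARD('p) - 1)", OF _ _ _ f(1) \<open>f \<noteq> 0\<close> f(3)])
        (use val_y[of i] val_y_denominator[of _ i] p_ge_2 in \<open>simp_all only: val_eq, simp\<close>)
    then show "\<exists>n. has_val x (of_int n / of_nat (e (Suc i)))" by (simp add: e_Suc f(2))
  qed
qed

end

section \<open>Ramification groups\<close>

lemma inv_of_padic_int [simp]: "inv_into UNIV of_padic_int (of_padic_int a) = a"
  by (rule inv_f_f) (auto intro: injI)

text \<open>One side has polynomials over the algebraic closure with coefficients in the image of
  the p-adic integers, the other has polynomials over the p-adic integers. Inverting the embedding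
  on each coefficient translates between them.\<close>

lemma integer_ring_eq:
  fixes A :: "'p::prime_card padic alg_closure set"
  shows "integer_ring A = on_carrier {x \<in> A. padic.integral x}"
proof -
  have "padic.integral x \<longleftrightarrow> (\<exists>f. Polynomial.lead_coeff f = 1 \<and>
      (\<forall>n. Polynomial.coeff f n \<in> range of_padic_int) \<and> poly f x = 0)" (is "_ \<longleftrightarrow> ?R")
    for x :: "'p padic alg_closure"
  proof
    assume "padic.integral x"
    then obtain f :: "'p padic_int poly"
      where f: "Polynomial.lead_coeff f = 1" "poly (map_poly of_padic_int f) x = 0"
      unfolding padic.integral_def by blast
    have "Polynomial.degree (map_poly of_padic_int f) = Polynomial.degree f"
      by (rule map_poly_degree_eq) (use f(1) in simp)
    then have "Polynomial.lead_coeff (map_poly of_padic_int f) = 1"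
      using f(1) by (simp add: coeff_map_poly)
    then show ?R using f(2) by (intro exI[of _ "map_poly of_padic_int f"]) (simp add: coeff_map_poly)
  next
    assume ?R
    then obtain f where f: "Polynomial.lead_coeff f = 1" "\<And>n. Polynomial.coeff f n \<in> range of_padic_int"
      "poly f x = 0" by blast
    define g where "g = map_poly (inv_into UNIV of_padic_int) f"
    have inv0: "inv_into UNIV of_padic_int (0 :: 'p padic alg_closure) = 0"
      and inv1: "inv_into UNIV of_padic_int (1 :: 'p padic alg_closure) = 1"
      using inv_of_padic_int[of 0] inv_of_padic_int[of 1] by simp_all
    have "map_poly of_padic_int g = f"
      by (rule poly_eqI) (simp add: g_def coeff_map_poly inv0 f_inv_into_f[OF f(2)])
    moreover have "Polynomial.degree g = Polynomial.degree f"
      unfolding g_def by (rule map_poly_degree_eq) (simp add: f(1) inv1)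
    then have "Polynomial.lead_coeff g = 1"
      using f(1) by (simp add: g_def coeff_map_poly inv0 inv1)
    ultimately show "padic.integral x" using f(3) unfolding padic.integral_def by blast
  qed
  then show ?thesis unfolding integer_ring_def of_padic_int_def[symmetric] by simp
qed

lemma prime_of_eq:
  assumes "type_subfield A"
  shows "prime_of A = {x \<in> A. padic.integral x \<and> \<not> int_unit x}"
proof -
  interpret type_subfield A by fact
  have "Units (on_carrier {x \<in> A. padic.integral x}) = {x \<in> A. int_unit x}"
  proof safe
    fix x assume "x \<in> Units (on_carrier {x \<in> A. padic.integral x})"
    then obtain z where "x \<in> A" "padic.integral x" "padic.integral z" "x * z = 1"
      unfolding Units_def by auto
    then show "x \<in> A" "int_unit x" using int_unit_factor[of x z] by auto
  next
    fix x assume "x \<in> A" "int_unit x"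
    then show "x \<in> Units (on_carrier {x \<in> A. padic.integral x})"
      unfolding Units_def by (auto simp: int_unit_def intro!: bexI[of _ "inverse x"])
  qed
  then show ?thesis unfolding prime_of_def integer_ring_eq by auto
qed

section \<open>A single step of the tower\<close>

locale tower_step = kummer_tower b \<zeta> \<beta>
  for b :: "'p::prime_card padic" and \<zeta> \<beta> +
  fixes i :: nat
begin

sublocale padic_subfield "K i" "e i"
  by (rule padic_subfield_K)

sublocale kummer_extension "K i" \<zeta> "\<beta> (Suc i)" "CARD('p)"
  by (rule kummer_extension_K(1)[OF padic_subfield_K])

lemma L_eq: "K (Suc i) = L"
  by (rule kummer_extension_K(2)[OF padic_subfield_K])

lemma val_L: "x \<in> L \<Longrightarrow> x \<noteq> 0 \<Longrightarrow> \<exists>n. has_val x (of_int n / of_nat (e (Suc i)))"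
  by (rule padic_subfield.val_denominator[OF padic_subfield_K[of "Suc i"], unfolded L_eq])

abbreviation Y where "Y \<equiv> y (Suc i)"

lemma Y_mem: "Y \<in> L" and lam_mem: "lam \<in> L"
  using y_mem_K[of "Suc i"] lam_mem_K[of "Suc i"] by (simp_all only: L_eq)

lemma Y_nonzero: "Y \<noteq> 0"
  by (rule has_val_nonzero[OF val_y])

definition m :: nat where
  "m = (\<Sum>k<Suc i. CARD('p) ^ k)"

lemma m_eq: "of_nat CARD('p) ^ Suc i - 1 = ((of_nat CARD('p) - 1) * of_nat m :: rat)"
  unfolding m_def power_diff_1_eq by simp

text \<open>m is 1 modulo p. Therefore (1 + \<epsilon>)^m - 1 has the same value as
  \<epsilon>.\<close>

lemma m_not_dvd: "\<not> CARD('p) dvd m"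
proof -
  have "m = 1 + CARD('p) * (\<Sum>k<i. CARD('p) ^ k)"
    unfolding m_def sum.lessThan_Suc_shift by (simp add: sum_distrib_left)
  then have "CARD('p) dvd m \<longleftrightarrow> CARD('p) dvd 1"
    by (metis dvd_add_left_iff dvd_triv_left)
  then show ?thesis using p_ge_2 by simp
qed

text \<open>As \<open>m = (p ^ (i + 1) - 1) / (p - 1)\<close>, the quotient \<open>lam / Y ^ m\<close> has the least positive
  valuation in \<open>L\<close>.\<close>

definition \<pi> :: "'p padic alg_closure" where
  "\<pi> = lam / Y ^ m"

lemma \<pi>_mem: "\<pi> \<in> L"
  unfolding \<pi>_def by (intro L.divide_mem L.power_mem Y_mem lam_mem)

text \<open>Over the common denominator (p - 1) p^(i + 1) the numerator is p^(i + 1) - (p - 1) m =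
  1, which is what m is made for.\<close>

lemma val_\<pi>: "has_val \<pi> (1 / of_nat (e (Suc i)))"
proof -
  have "has_val \<pi> (1 / (of_nat CARD('p) - 1) - of_nat m * (1 / of_nat (CARD('p) ^ Suc i)))"
    unfolding \<pi>_def by (rule has_val_divide[OF val_lam has_val_power[OF val_y]])
  moreover have "(1 / (of_nat CARD('p) - 1) - of_nat m * (1 / of_nat (CARD('p) ^ Suc i)) :: rat)
      = 1 / of_nat (e (Suc i))"
  proof -
    have nz: "(of_nat CARD('p) - 1 :: rat) \<noteq> 0" "(of_nat CARD('p) ^ Suc i :: rat) \<noteq> 0"
      using p_ge_2 by auto
    have "(1 / (of_nat CARD('p) - 1) - of_nat m * (1 / of_nat CARD('p) ^ Suc i) :: rat)
        = (of_nat CARD('p) ^ Suc i - (of_nat CARD('p) - 1) * of_nat m)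
          / ((of_nat CARD('p) - 1) * of_nat CARD('p) ^ Suc i)"
      using nz by (simp add: divide_simps)
    also have "\<dots> = 1 / ((of_nat CARD('p) - 1) * of_nat CARD('p) ^ Suc i)"
      unfolding m_eq[symmetric] by simp
    also have "(of_nat CARD('p) - 1) * of_nat CARD('p) ^ Suc i = (of_nat (e (Suc i)) :: rat)"
      using p_ge_2 by (simp add: e_def of_nat_diff mult.commute)
    finally show ?thesis by simp
  qed
  ultimately show ?thesis by simp
qed

lemma \<pi>_nonzero: "\<pi> \<noteq> 0"
  by (rule has_val_nonzero[OF val_\<pi>])

text \<open>The ideal generated by \<pi>^n in the integers of \<open>L\<close>, written so that
  membership can be read off values. By \<open>prime_power_L\<close> it is the n-th power of the
  maximal ideal.\<close>

definition filt :: "nat \<Rightarrow> 'p padic alg_closure set" where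
  "filt n = {x \<in> L. padic.integral (x / \<pi> ^ n)}"

lemma filt_iff:
  assumes "has_val x q" "x \<in> L"
  shows "x \<in> filt n \<longleftrightarrow> of_nat n / of_nat (e (Suc i)) \<le> q"
  using has_val_integral_iff[OF has_val_divide[OF assms(1) has_val_power[OF val_\<pi>, of n]]] assms(2)
  by (simp add: filt_def)

lemma filt_0: "filt 0 = {x \<in> L. padic.integral x}"
  by (simp add: filt_def)

lemma zero_mem_filt: "0 \<in> filt n"
  by (simp add: filt_def)

lemma filt_add: "x \<in> filt n \<Longrightarrow> z \<in> filt n \<Longrightarrow> x + z \<in> filt n"
  by (auto simp: filt_def add_divide_distrib)

lemma filt_sum: "(\<And>k. k \<in> A \<Longrightarrow> f k \<in> filt n) \<Longrightarrow> (\<Sum>k\<in>A. f k) \<in> filt n"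
  by (induction A rule: infinite_finite_induct) (auto simp: zero_mem_filt filt_add)

lemma filt_mult:
  assumes "x \<in> filt k" "z \<in> filt l"
  shows "x * z \<in> filt (k + l)"
proof -
  have "x * z / \<pi> ^ (k + l) = (x / \<pi> ^ k) * (z / \<pi> ^ l)" by (simp add: power_add)
  moreover have "padic.integral ((x / \<pi> ^ k) * (z / \<pi> ^ l))" "x \<in> L" "z \<in> L"
    using assms by (auto simp: filt_def simp del: times_divide_eq_left times_divide_eq_right times_divide_times_eq)
  ultimately show ?thesis by (simp only: filt_def mem_Collect_eq L.mult_mem simp_thms)
qed

lemma filt_antimono:
  assumes "k \<le> l"
  shows "filt l \<subseteq> filt k"
proof
  fix x assume x: "x \<in> filt l"
  have "\<pi> ^ l = \<pi> ^ (l - k) * \<pi> ^ k" using assms by (simp flip: power_add)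
  then have "x / \<pi> ^ k = (x / \<pi> ^ l) * \<pi> ^ (l - k)" using \<pi>_nonzero by simp
  moreover have "padic.integral \<pi>" using has_val_integral_iff[OF val_\<pi>] by simp
  then have "padic.integral ((x / \<pi> ^ l) * \<pi> ^ (l - k))"
    using x by (intro integral_mult integral_power) (simp_all add: filt_def)
  ultimately show "x \<in> filt k" using x by (simp add: filt_def)
qed

text \<open>Values on \<open>L\<close> are multiples of 1 / \<open>e (Suc i)\<close>, the value of
  \<pi>, so a positive one is at least that of \<pi>.\<close>

lemma prime_of_L: "prime_of L = filt 1"
proof -
  have "padic.integral x \<and> \<not> int_unit x \<longleftrightarrow> x \<in> filt 1" if x: "x \<in> L" for x
  proof (cases "x = 0")
    case True
    then show ?thesis by (simp add: zero_mem_filt int_unit_def)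
  next
    case False
    then obtain n where n: "has_val x (of_int n / of_nat (e (Suc i)))" using val_L[OF x False] by blast
    have "padic.integral x \<and> \<not> int_unit x \<longleftrightarrow> 1 \<le> n"
      using has_val_integral_iff[OF n] has_val_unit_iff[OF n] e_pos[of "Suc i"]
      by (auto simp: zero_le_divide_iff)
    also have "\<dots> \<longleftrightarrow> x \<in> filt 1"
      using filt_iff[OF n x, of 1] e_pos[of "Suc i"] by (simp add: divide_le_cancel)
    finally show ?thesis .
  qed
  moreover have "filt 1 \<subseteq> L" by (auto simp: filt_def)
  ultimately show ?thesis
    unfolding prime_of_eq[OF L.type_subfield_axioms] by blast
qed

text \<open>For the harder inclusion, x in \<open>filt (Suc n)\<close> is the product of x / \<pi>
  in \<open>filt n\<close> and \<pi> in \<open>filt 1\<close>.\<close>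

lemma prime_power_L: "prime_of L [^]\<^bsub>ideals_set (integer_ring L)\<^esub> n = filt n"
proof (induction n)
  case 0
  show ?case by (simp add: nat_pow_def ideals_set_def integer_ring_eq filt_0)
next
  case (Suc n)
  let ?R = "integer_ring L"
  have "prime_of L [^]\<^bsub>ideals_set ?R\<^esub> Suc n
      = ideal_prod ?R (prime_of L [^]\<^bsub>ideals_set ?R\<^esub> n) (prime_of L)"
    by (simp add: nat_pow_def ideals_set_def)
  also have "\<dots> = ideal_prod ?R (filt n) (filt 1)" by (simp only: Suc) (simp only: prime_of_L)
  also have "\<dots> = filt (Suc n)"
  proof
    show "ideal_prod ?R (filt n) (filt 1) \<subseteq> filt (Suc n)"
    proof
      fix s assume "s \<in> ideal_prod ?R (filt n) (filt 1)"
      then show "s \<in> filt (Suc n)"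
      proof (induction rule: ideal_prod.induct)
        case (prod x z)
        then show ?case using filt_mult[of x n z 1] by (simp add: integer_ring_eq)
      next
        case (sum x z)
        then show ?case by (simp add: integer_ring_eq filt_add)
      qed
    qed
    show "filt (Suc n) \<subseteq> ideal_prod ?R (filt n) (filt 1)"
    proof
      fix x assume x: "x \<in> filt (Suc n)"
      have "x / \<pi> / \<pi> ^ n = x / \<pi> ^ Suc n" by simp
      then have "x / \<pi> \<in> filt n" using x \<pi>_mem by (auto simp: filt_def)
      moreover have "\<pi> \<in> filt 1" using \<pi>_mem \<pi>_nonzero by (simp add: filt_def)
      ultimately have "x / \<pi> \<otimes>\<^bsub>?R\<^esub> \<pi> \<in> ideal_prod ?R (filt n) (filt 1)" by (rule ideal_prod.prod)
      then show "x \<in> ideal_prod ?R (filt n) (filt 1)" using \<pi>_nonzero by (simp add: integer_ring_eq)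
    qed
  qed
  finally show ?case .
qed

text \<open>The number 1 + p (p^i - 1), in the form in which it arises as numerator of 1 / (p - 1) -
  1 / p^(i + 1) over \<open>e (Suc i)\<close>. By \<open>t_eq\<close> the subtraction is not
  truncated.\<close>

definition t :: nat where
  "t = CARD('p) ^ Suc i - (CARD('p) - 1)"

lemma t_eq: "CARD('p) ^ Suc i = t + (CARD('p) - 1)"
proof -
  have "CARD('p) ^ 1 \<le> CARD('p) ^ Suc i" using p_ge_2 by (intro power_increasing) auto
  then have "CARD('p) - 1 \<le> CARD('p) ^ Suc i"
    unfolding power_one_right by (rule le_trans[OF diff_le_self])
  then show ?thesis by (simp only: t_def le_add_diff_inverse2)
qed

lemma t_pos: "t > 0"
proof -
  have "CARD('p) ^ 1 \<le> CARD('p) ^ Suc i" using p_ge_2 by (intro power_increasing) auto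
  then show ?thesis using p_ge_2 unfolding t_def power_one_right by linarith
qed

text \<open>The relative displacement of \<open>Y\<close>: conjugation multiplies 1 + Y by
  \<zeta>^j, so it adds (\<zeta>^j - 1) (1 + Y) to \<open>Y\<close>.\<close>

definition eps :: "nat \<Rightarrow> 'p padic alg_closure" where
  "eps j = (\<zeta> ^ j - 1) * (1 + Y) / Y"

lemma galois_conj_Y: "galois_conj j Y = Y * (1 + eps j)"
proof -
  have B: "inverse B \<in> K i" by (intro inverse_mem to_ac_mem_K)
  then have BL: "inverse B \<in> L" using subset_adjoin by blast
  have "galois_conj j (\<beta> (Suc i) * inverse B - 1) = \<zeta> ^ j * \<beta> (Suc i) * inverse B - 1"
    by (simp add: galois_conj_diff galois_conj_mult galois_conj_fixes galois_conj_beta B BL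
      mem_adjoin L.mult_mem)
  then have "galois_conj j Y = \<zeta> ^ j * (1 + Y) - 1"
    by (simp add: y_def divide_inverse mult.assoc)
  also have "\<dots> = Y * (1 + eps j)" using Y_nonzero by (simp add: eps_def field_simps)
  finally show ?thesis .
qed

lemma val_eps:
  assumes "0 < j" "j < CARD('p)"
  shows "has_val (eps j) (of_nat t / of_nat (e (Suc i)))"
proof -
  have "(\<zeta> ^ j) ^ CARD('p) = (\<zeta> ^ CARD('p)) ^ j" by (simp only: power_mult[symmetric] mult.commute)
  then have "(\<zeta> ^ j) ^ CARD('p) = 1" by simp
  moreover have "\<zeta> ^ j \<noteq> 1" using zeta assms by (simp add: primitive_root_of_unity_def)
  ultimately have "has_val (\<zeta> ^ j - 1) (1 / (of_nat CARD('p) - 1))" by (rule has_val_root_of_unity)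
  moreover have "int_unit (1 + Y)"
    using int_unit_divide[OF beta_unit B_unit, of "Suc i"] by (simp add: y_def)
  ultimately have "has_val (eps j) (1 / (of_nat CARD('p) - 1) - 1 / of_nat (CARD('p) ^ Suc i))"
    unfolding eps_def by (intro has_val_divide[OF has_val_mult_unit val_y])
  moreover have "(1 / (of_nat CARD('p) - 1) - 1 / of_nat (CARD('p) ^ Suc i) :: rat)
      = of_nat t / of_nat (e (Suc i))"
  proof -
    define a where "a = (of_nat CARD('p) - 1 :: rat)"
    define c where "c = (of_nat (CARD('p) ^ Suc i) :: rat)"
    have nz: "a \<noteq> 0" "c \<noteq> 0" using p_ge_2 by (auto simp: a_def c_def)
    have a: "of_nat (CARD('p) - 1) = a" using p_ge_2 by (simp add: a_def of_nat_diff)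
    have "c = of_nat t + a" unfolding c_def t_eq of_nat_add a ..
    then have "of_nat t = c - a" by simp
    moreover have "of_nat (e (Suc i)) = c * a" unfolding e_def of_nat_mult a c_def ..
    ultimately show ?thesis unfolding a_def[symmetric] c_def[symmetric]
      using nz by (simp add: diff_divide_distrib)
  qed
  ultimately show ?thesis by simp
qed

lemma eps_integral: "j < CARD('p) \<Longrightarrow> padic.integral (eps j / \<pi> ^ t)"
proof (cases "j = 0")
  case False
  assume "j < CARD('p)"
  with False have "has_val (eps j) (of_nat t / of_nat (e (Suc i)))" by (intro val_eps) auto
  then show ?thesis
    using has_val_integral_iff[OF has_val_divide[OF _ has_val_power[OF val_\<pi>, of t]]] by fastforce
qed (simp add: eps_def)

text \<open>Writing \<open>x\<close> as a sum of integral terms \<open>c k * Y ^ k\<close> with \<open>k < p\<close>, the conjugation moves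
  each of them by the factor \<open>(1 + eps j) ^ k - 1\<close>. The term \<open>k = 0\<close> does not move, and the
  others are not units because of their valuation, which gives one more power of \<open>\<pi>\<close>.\<close>

lemma galois_conj_diff_mem_filt:
  assumes x: "x \<in> L" "padic.integral x" and j: "j < CARD('p)"
  shows "galois_conj j x - x \<in> filt (Suc t)"
proof (cases "x = 0")
  case True
  then show ?thesis by (simp add: galois_conj_fixes zero_mem_filt)
next
  case False
  have "x \<in> K (Suc i)" using x(1) by (simp add: L_eq)
  then obtain f where f: "poly_over f" "x = poly f Y" "Polynomial.degree f < CARD('p)"
    using K_Suc_reduced[OF padic_subfield_K] by blast
  have f0: "f \<noteq> 0" using f(2) False by auto
  have cL: "Polynomial.coeff f k \<in> L" for k using poly_over_coeff[OF f(1)] subset_adjoin by auto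
  let ?N = "e (Suc i)"
  have denom: "of_nat k * (1 / of_nat (CARD('p) ^ Suc i)) * of_nat (e i) \<notin> (\<int> :: rat set)"
    if "0 < k" "k < CARD('p)" for k
    using that by (rule val_y_denominator)
  obtain k0 n0 where "k0 < CARD('p)"
    and val_f: "has_val (poly f Y) (of_int n0 / of_nat (e i) + of_nat k0 * (1 / of_nat (CARD('p) ^ Suc i)))"
    and terms: "\<forall>k. Polynomial.coeff f k \<noteq> 0 \<longrightarrow>
       (\<exists>l. has_val (Polynomial.coeff f k * Y ^ k) (of_int l / of_nat (e i) + of_nat k * (1 / of_nat (CARD('p) ^ Suc i))) \<and>
         of_int n0 / of_nat (e i) + of_nat k0 * (1 / of_nat (CARD('p) ^ Suc i))
           \<le> (of_int l / of_nat (e i) + of_nat k * (1 / of_nat (CARD('p) ^ Suc i)) :: rat))"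
    using poly_val[OF val_y denom f(1) f0 f(3)] .
  note val_x = val_f[folded f(2)]
  have "galois_conj j x = (\<Sum>k\<le>Polynomial.degree f. Polynomial.coeff f k * (Y * (1 + eps j)) ^ k)"
    by (simp add: f(2) poly_altdef galois_conj_sum galois_conj_mult galois_conj_power galois_conj_Y
      galois_conj_fixes poly_over_coeff[OF f(1)] cL Y_mem L.mult_mem L.power_mem)
  also have "\<dots> = (\<Sum>k\<le>Polynomial.degree f.
      Polynomial.coeff f k * Y ^ k * ((1 + eps j) ^ k - 1) + Polynomial.coeff f k * Y ^ k)"
    by (rule sum.cong[OF refl], unfold power_mult_distrib) (simp add: right_diff_distrib mult.assoc)
  also have "\<dots> = (\<Sum>k\<le>Polynomial.degree f. Polynomial.coeff f k * Y ^ k * ((1 + eps j) ^ k - 1)) + x"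
    by (simp add: sum.distrib f(2) poly_altdef)
  finally have eq: "galois_conj j x - x
      = (\<Sum>k\<le>Polynomial.degree f. Polynomial.coeff f k * Y ^ k * ((1 + eps j) ^ k - 1))"
    by simp
  have epsL: "eps j \<in> L"
    unfolding eps_def using zeta_mem_K[of "Suc i"] Y_mem L_eq
    by (intro L.divide_mem L.mult_mem L.add_mem L.diff_mem L.power_mem L.one_mem) auto
  have \<pi>: "padic.integral \<pi>" using has_val_integral_iff[OF val_\<pi>] by simp
  have eps: "padic.integral (eps j)"
    using integral_mult[OF eps_integral[OF j] integral_power[OF \<pi>, of t]] \<pi>_nonzero by simp
  have "Polynomial.coeff f k * Y ^ k * ((1 + eps j) ^ k - 1) \<in> filt (Suc t)"
    if k: "k \<le> Polynomial.degree f" for k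
  proof (cases "k = 0 \<or> Polynomial.coeff f k = 0")
    case True
    then show ?thesis by (auto simp: zero_mem_filt)
  next
    case False
    define v :: "int \<Rightarrow> rat" where "v l = of_int l / of_nat (e i) + of_nat k * (1 / of_nat (CARD('p) ^ Suc i))" for l
    obtain l where l: "has_val (Polynomial.coeff f k * Y ^ k) (v l)"
      and le: "of_int n0 / of_nat (e i) + of_nat k0 * (1 / of_nat (CARD('p) ^ Suc i)) \<le> v l"
      using terms[rule_format, of k] False unfolding v_def by blast
    have "v l \<ge> 0" using le has_val_integral_iff[OF val_x] x(2) by linarith
    \<comment> \<open>With value 0, the value of Y^k would be the negative of the value of a
      coefficient in \<open>K i\<close>, against \<open>denom\<close>.\<close>
    moreover have "v l \<noteq> 0"
    proof
      assume "v l = 0"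
      then have "of_nat k * (1 / of_nat (CARD('p) ^ Suc i)) = - (of_int l / of_nat (e i) :: rat)"
        unfolding v_def by linarith
      moreover have "- (of_int l / of_nat (e i)) * of_nat (e i) = (of_int (- l) :: rat)"
        using e_pos[of i] by simp
      ultimately have "of_nat k * (1 / of_nat (CARD('p) ^ Suc i)) * of_nat (e i) = (of_int (- l) :: rat)"
        by (simp only:)
      then have "of_nat k * (1 / of_nat (CARD('p) ^ Suc i)) * of_nat (e i) \<in> (\<int> :: rat set)"
        by (simp only: Ints_of_int)
      moreover have "of_nat k * (1 / of_nat (CARD('p) ^ Suc i)) * of_nat (e i) \<notin> (\<int> :: rat set)"
        using False k f(3) by (intro denom) auto
      ultimately show False by contradiction
    qed
    ultimately have v_pos: "v l > 0" by linarith
    have termL: "Polynomial.coeff f k * Y ^ k \<in> L" using cL Y_mem by blast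
    then obtain n where n: "has_val (Polynomial.coeff f k * Y ^ k) (of_int n / of_nat ?N)"
      using val_L has_val_nonzero[OF l] by blast
    then have "of_int n / of_nat ?N > (0 :: rat)"
      using has_val_unique[OF l n] v_pos by (simp only:)
    \<comment> \<open>Positive values on \<open>L\<close> are at least that of \<pi>: this is the
      additional factor \<pi>.\<close>
    then have "n \<ge> 1" using e_pos[of "Suc i"] by (simp add: zero_less_divide_iff)
    then have "of_nat 1 / of_nat ?N \<le> (of_int n / of_nat ?N :: rat)"
      using e_pos[of "Suc i"] by (intro divide_right_mono) auto
    then have "Polynomial.coeff f k * Y ^ k \<in> filt 1" using filt_iff[OF n termL] by simp
    moreover have "eps j \<in> filt t" using epsL eps_integral[OF j] by (simp add: filt_def)
    moreover have "(\<Sum>l<k. (1 + eps j) ^ l) \<in> filt 0"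
      unfolding filt_0 using epsL eps
      by (auto intro!: L.sum_mem L.power_mem L.add_mem L.one_mem integral_sum integral_power integral_add)
    \<comment> \<open>The term contributes one power of \<pi>, \<open>eps j\<close> contributes t of
      them, and the geometric sum is merely integral.\<close>
    ultimately have "Polynomial.coeff f k * Y ^ k * (eps j * (\<Sum>l<k. (1 + eps j) ^ l)) \<in> filt (1 + (t + 0))"
      by (intro filt_mult)
    moreover have "(1 + eps j) ^ k - 1 = eps j * (\<Sum>l<k. (1 + eps j) ^ l)"
      using power_diff_1_eq[of "1 + eps j" k] by simp
    ultimately show ?thesis by simp
  qed
  then show ?thesis unfolding eq by (intro filt_sum) auto
qed

text \<open>Since \<pi> Y^m = \<open>lam\<close> is fixed, the conjugate s of \<pi> satisfies s (1 +
  \<epsilon>)^m = \<pi>. So s - \<pi> = - s ((1 + \<epsilon>)^m - 1) has exactly t + 1 times the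
  value of \<pi>.\<close>

lemma galois_conj_\<pi>_not_mem_filt:
  assumes j: "0 < j" "j < CARD('p)"
  shows "galois_conj j \<pi> - \<pi> \<notin> filt (Suc (Suc t))"
proof -
  let ?N = "e (Suc i)" and ?s = "galois_conj j \<pi>"
  have pos: "(of_nat t / of_nat ?N :: rat) > 0" using t_pos e_pos[of "Suc i"] by simp
  note eps = val_eps[OF j]
  have unit: "int_unit (1 + eps j)"
    using int_unit_one_minus[OF has_val_uminus[OF eps] pos] by simp
  have "galois_conj j (\<pi> * Y ^ m) = ?s * (Y * (1 + eps j)) ^ m"
    by (simp add: galois_conj_mult galois_conj_power galois_conj_Y \<pi>_mem Y_mem L.power_mem)
  moreover have "\<pi> * Y ^ m = lam" using Y_nonzero by (simp add: \<pi>_def)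
  ultimately have "?s * (Y * (1 + eps j)) ^ m = \<pi> * Y ^ m"
    using galois_conj_fixes[OF lam_mem_K[of i], of j] by simp
  then have eq: "?s * (1 + eps j) ^ m = \<pi>"
    using Y_nonzero by (simp add: power_mult_distrib)
  then have "?s = \<pi> * inverse ((1 + eps j) ^ m)"
    using unit by (auto simp: int_unit_def field_simps)
  then have "has_val ?s (1 / of_nat ?N)"
    using val_\<pi> unit by (auto intro: has_val_mult_unit)
  moreover have "has_val ((1 + eps j) ^ m - 1) (of_nat t / of_nat ?N)"
    by (rule has_val_one_plus_power_diff[OF eps pos m_not_dvd])
  ultimately have "has_val (?s * ((1 + eps j) ^ m - 1)) (1 / of_nat ?N + of_nat t / of_nat ?N)"
    by (rule has_val_mult)
  then have "has_val (- (?s * ((1 + eps j) ^ m - 1))) (1 / of_nat ?N + of_nat t / of_nat ?N)"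
    by (rule has_val_uminus)
  moreover have "- (?s * ((1 + eps j) ^ m - 1)) = ?s - \<pi>"
    using eq by (simp add: algebra_simps)
  ultimately have "has_val (?s - \<pi>) (1 / of_nat ?N + of_nat t / of_nat ?N)" by simp
  moreover have "?s - \<pi> \<in> L" by (intro L.diff_mem galois_conj_mem \<pi>_mem)
  moreover have "\<not> of_nat (Suc (Suc t)) / of_nat ?N \<le> (1 / of_nat ?N + of_nat t / of_nat ?N :: rat)"
    using e_pos[of "Suc i"] by (simp add: add_divide_distrib[symmetric] divide_le_cancel)
  ultimately show ?thesis using filt_iff by blast
qed

section \<open>The ramification groups of the step\<close>

lemma ramification_group_iff:
  "\<sigma> \<in> ramification_group (K i) L n \<longleftrightarrow> \<sigma> \<in> carrier (galois_group (K i) L) \<and>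
     (\<forall>x\<in>L. padic.integral x \<longrightarrow> \<sigma> x - x \<in> filt (nat (n + 1)))"
  unfolding ramification_group_def prime_power_L by (auto simp: integer_ring_eq)

text \<open>The group with index n is defined by the power n + 1 of the maximal ideal, so the bound
  \<open>Suc t\<close> reaches exactly up to n = t.\<close>

lemma ramification_group_le:
  assumes "n \<le> int t"
  shows "ramification_group (K i) L n = carrier (galois_group (K i) L)"
proof -
  have "\<sigma> x - x \<in> filt (nat (n + 1))"
    if \<sigma>: "\<sigma> \<in> carrier (galois_group (K i) L)" and x: "x \<in> L" "padic.integral x" for \<sigma> x
  proof -
    obtain j where j: "j < CARD('p)" "\<sigma> = galois_aut j" using \<sigma> by (rule galois_group_cases)
    then have "\<sigma> x - x \<in> filt (Suc t)"
      using galois_conj_diff_mem_filt[OF x j(1)] x(1) by (simp add: galois_aut_def)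
    moreover have "nat (n + 1) \<le> Suc t" using assms by simp
    ultimately show ?thesis using filt_antimono by blast
  qed
  then show ?thesis by (auto simp: ramification_group_iff)
qed

lemma ramification_group_gt:
  assumes "n > int t"
  shows "ramification_group (K i) L n = {\<one>\<^bsub>galois_group (K i) L\<^esub>}"
proof
  show "{\<one>\<^bsub>galois_group (K i) L\<^esub>} \<subseteq> ramification_group (K i) L n"
    using galois_aut_mem[of 0]
    by (simp add: ramification_group_iff galois_group_one galois_aut_def galois_conj_0 zero_mem_filt)
  show "ramification_group (K i) L n \<subseteq> {\<one>\<^bsub>galois_group (K i) L\<^esub>}"
  proof
    fix \<sigma> assume \<sigma>: "\<sigma> \<in> ramification_group (K i) L n"
    then obtain j where j: "j < CARD('p)" "\<sigma> = galois_aut j"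
      unfolding ramification_group_iff using galois_group_cases by blast
    have "padic.integral \<pi>" using has_val_integral_iff[OF val_\<pi>] by simp
    then have "galois_conj j \<pi> - \<pi> \<in> filt (nat (n + 1))"
      using \<sigma> \<pi>_mem j(2) by (auto simp: ramification_group_iff galois_aut_def)
    moreover have "Suc (Suc t) \<le> nat (n + 1)" using assms by simp
    ultimately have "galois_conj j \<pi> - \<pi> \<in> filt (Suc (Suc t))" using filt_antimono by blast
    then have "j = 0" using galois_conj_\<pi>_not_mem_filt j(1) by blast
    then show "\<sigma> \<in> {\<one>\<^bsub>galois_group (K i) L\<^esub>}" by (simp add: j(2) galois_group_one)
  qed
qed

lemma break_numbers: "break_numbers (K i) L = {int t}"
proof -
  \<comment> \<open>The jump at t is a real one because the group has order p > 1.\<close>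
  have "carrier (galois_group (K i) L) \<noteq> {\<one>\<^bsub>galois_group (K i) L\<^esub>}"
    using order_galois_group p_ge_2 by (auto simp: Coset.order_def)
  then have "ramification_group (K i) L (n + 1) \<noteq> ramification_group (K i) L n \<longleftrightarrow> n = int t" for n
    using ramification_group_le[of n] ramification_group_le[of "n + 1"]
      ramification_group_gt[of n] ramification_group_gt[of "n + 1"]
    by (cases "n < int t"; cases "n = int t") auto
  then show ?thesis by (auto simp: break_numbers_def)
qed

lemma int_t: "int t = 1 + int CARD('p) * (int CARD('p) ^ i - 1)"
proof -
  have "int (CARD('p) ^ Suc i) = int (t + (CARD('p) - 1))" by (simp only: t_eq)
  then show ?thesis using p_ge_2 by (simp add: of_nat_diff algebra_simps)
qed

end

theorem theorem5p6:
  fixes p :: nat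
    and b :: "'p::prime_card padic"
    and \<zeta> :: "'p padic alg_closure"
    and \<beta> :: "nat \<Rightarrow> 'p padic alg_closure"
    and K :: "nat \<Rightarrow> 'p padic alg_closure set"
  assumes "p = CARD('p)" and "odd p"
    and "padic_val (b ^ (p - 1) - 1) = 1"
    and "primitive_root_of_unity p \<zeta>"
    and "\<beta> 0 = to_ac b" and "\<And>i. i \<ge> 1 \<Longrightarrow> \<beta> i ^ p = \<beta> (i - 1)"
    and "K 0 = Qp_adjoin {\<zeta>}" and "\<And>i. i \<ge> 1 \<Longrightarrow> K i = Qp_adjoin {\<zeta>, \<beta> i}"
  shows "\<forall>i\<ge>1.
    galois_extension (K (i - 1)) (K i) \<and>
    group (galois_group (K (i - 1)) (K i)) \<and>
    cyclic_group (galois_group (K (i - 1)) (K i)) \<and>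
    Coset.order (galois_group (K (i - 1)) (K i)) = p \<and>
    (let t = 1 + int p * (int p ^ (i - 1) - 1) in
       break_numbers (K (i - 1)) (K i) = {t} \<and>
       ramification_group (K (i - 1)) (K i) t = carrier (galois_group (K (i - 1)) (K i)) \<and>
       ramification_group (K (i - 1)) (K i) (t + 1) = {\<one>\<^bsub>galois_group (K (i - 1)) (K i)\<^esub>})"
proof (intro allI impI)
  fix i :: nat assume "i \<ge> 1"
  define j where "j = i - 1"
  then have i: "i = Suc j" using \<open>i \<ge> 1\<close> by simp
  interpret tower_step b \<zeta> \<beta> j
  proof
    show "padic_val (b ^ (CARD('p) - 1) - 1) = 1" "primitive_root_of_unity CARD('p) \<zeta>" "\<beta> 0 = to_ac b"
      using assms(1,3-5) by simp_all
    show "\<beta> (Suc k) ^ CARD('p) = \<beta> k" for k using assms(1) assms(6)[of "Suc k"] by simp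
  qed
  \<comment> \<open>The theorem omits \<open>\<beta> 0\<close> in \<open>K 0\<close>, whereas the
    tower uses one formula for all indices.\<close>
  have "Qp_adjoin {\<zeta>, \<beta> 0} = Qp_adjoin {\<zeta>}"
    using Qp_adjoin_superset[of "{\<zeta>}"] Qp_adjoin_superset[of "{\<zeta>, \<beta> 0}"] assms(5)
    by (intro antisym Qp_adjoin_least Qp_adjoin_subfield) auto
  then have K: "K n = kummer_tower.K \<zeta> \<beta> n" for n
    unfolding K_def using assms(7) assms(8)[of n] by (cases n) auto
  have Ki: "K j = kummer_tower.K \<zeta> \<beta> j" "K i = L"
    unfolding K by (simp_all add: i L_eq)
  show "galois_extension (K (i - 1)) (K i) \<and>
    group (galois_group (K (i - 1)) (K i)) \<and>
    cyclic_group (galois_group (K (i - 1)) (K i)) \<and>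
    Coset.order (galois_group (K (i - 1)) (K i)) = p \<and>
    (let t = 1 + int p * (int p ^ (i - 1) - 1) in
       break_numbers (K (i - 1)) (K i) = {t} \<and>
       ramification_group (K (i - 1)) (K i) t = carrier (galois_group (K (i - 1)) (K i)) \<and>
       ramification_group (K (i - 1)) (K i) (t + 1) = {\<one>\<^bsub>galois_group (K (i - 1)) (K i)\<^esub>})"
    unfolding Let_def Ki assms(1) j_def[symmetric] int_t[symmetric]
    using galois_extension group_galois_group cyclic_galois_group order_galois_group break_numbers
      ramification_group_le[of "int t"] ramification_group_gt[of "int t + 1"]
    by simp
qed

end
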